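(* Let $\mu$ be a $\sigma$-finite positive measure on a set $X$, and let $K$ be a (bounded) positive kernel operator on the complex Hilbert space $L^2(X,\mu)$. For each $n \in \mathbb{N} \cup \{0\}$ put $$\rho_n = r\bigl(S(K^{2^n})\bigr)^{2^{-n}},$$ where $r(\cdot)$ denotes the spectral radius and $S(\cdot)$ the geometric symmetrization. Then, for each $n \in \mathbb{N} \cup \{0\}$, $$\rho_0 \le \rho_1 \le \ldots \le \rho_n \le r(K).$$
   Context: All operators are bounded linear operators on the complex Hilbert space $L^2(X,\mu)$, where $\mu$ is a $\sigma$-finite positive measure on $X$. The spectral radius of an operator is denoted by $r(\cdot)$. A positive kernel operator on $L^2(X,\mu)$ with kernel $k$ is a (bounded) operator $K$ for which $k : X \times X \to [0,\infty)$ is a measurable function such that $(Kf)(x) = \int_X k(x,y) f(y)\, d\mu(y)$ for all $f \in L^2(X,\mu)$ and for almost all $x \in X$. The product of two positive kernel operators is a positive kernel operator; in particular $K^2$ has kernel $(x,y) \mapsto \int_X k(x,z)k(z,y)\,d\mu(z)$ (kernels being understood up to almost everywhere equality), and all powers $K^{2^n}$ are positive kernel operators. The geometric symmetrization $S(K)$ of a positive kernel operator $K$ with kernel $k$ is the positive selfadjoint kernel operator on $L^2(X,\mu)$ with kernel $(x,y) \mapsto \sqrt{k(x,y)\,k(y,x)}$. It is well-defined and bounded on all of $L^2(X,\mu)$, because its kernel is at most $(k(x,y)+k(y,x))/2$, which is the kernel of $(K+K^* )/2$. *)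

theory Defs
  imports "HOL-Analysis.Analysis"
begin

text \<open>
  The complex Hilbert space of square-integrable functions is represented by functions
  rather than by equivalence classes: an element is a square-integrable function, and equality
  in the Hilbert space is equality almost everywhere.  An operator acts on representatives,
  and every condition imposed on operators below is stated up to almost everywhere equality.
\<close>

definition L2_space :: "'a measure \<Rightarrow> ('a \<Rightarrow> complex) set" where
  "L2_space M = {f. f \<in> borel_measurable M \<and> integrable M (\<lambda>x. (cmod (f x))\<^sup>2)}"

definition L2_norm :: "'a measure \<Rightarrow> ('a \<Rightarrow> complex) \<Rightarrow> real" where
  "L2_norm M f = sqrt (\<integral>x. (cmod (f x))\<^sup>2 \<partial>M)"

definition L2_bounded_operator ::
    "'a measure \<Rightarrow> (('a \<Rightarrow> complex) \<Rightarrow> ('a \<Rightarrow> complex)) \<Rightarrow> bool" where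
  "L2_bounded_operator M T \<longleftrightarrow>
     (\<forall>f\<in>L2_space M. T f \<in> L2_space M) \<and>
     (\<forall>f\<in>L2_space M. \<forall>g\<in>L2_space M.
        (AE x in M. f x = g x) \<longrightarrow> (AE x in M. T f x = T g x)) \<and>
     (\<forall>f\<in>L2_space M. \<forall>g\<in>L2_space M.
        AE x in M. T (\<lambda>y. f y + g y) x = T f x + T g x) \<and>
     (\<forall>c. \<forall>f\<in>L2_space M. AE x in M. T (\<lambda>y. c * f y) x = c * T f x) \<and>
     (\<exists>C. \<forall>f\<in>L2_space M. L2_norm M (T f) \<le> C * L2_norm M f)"

text \<open>
  A number \<open>c\<close> is in the spectrum of \<open>T\<close> if \<open>T - c I\<close> has no two-sided inverse among the
  bounded operators.
\<close>

definition L2_spectrum ::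
    "'a measure \<Rightarrow> (('a \<Rightarrow> complex) \<Rightarrow> ('a \<Rightarrow> complex)) \<Rightarrow> complex set" where
  "L2_spectrum M T = {c. \<not> (\<exists>R. L2_bounded_operator M R \<and>
     (\<forall>f\<in>L2_space M.
        (AE x in M. R (\<lambda>y. T f y - c * f y) x = f x) \<and>
        (AE x in M. T (R f) x - c * R f x = f x)))}"

text \<open>
  The spectrum of a bounded operator is bounded, and it is empty only if the Hilbert space is
  trivial.  Inserting \<open>0\<close> fixes the convention that the spectral radius is \<open>0\<close> in that
  case and changes nothing otherwise.
\<close>

definition L2_spectral_radius ::
    "'a measure \<Rightarrow> (('a \<Rightarrow> complex) \<Rightarrow> ('a \<Rightarrow> complex)) \<Rightarrow> real" where
  "L2_spectral_radius M T = Sup (insert 0 (cmod ` L2_spectrum M T))"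

text \<open>
  Integrability is required explicitly, since the Bochner integral of a non-integrable function
  is \<open>0\<close> by convention.
\<close>

definition is_kernel_of ::
    "'a measure \<Rightarrow> ('a \<times> 'a \<Rightarrow> real) \<Rightarrow> (('a \<Rightarrow> complex) \<Rightarrow> ('a \<Rightarrow> complex)) \<Rightarrow> bool" where
  "is_kernel_of M k K \<longleftrightarrow>
     k \<in> borel_measurable (M \<Otimes>\<^sub>M M) \<and>
     (\<forall>x\<in>space M. \<forall>y\<in>space M. 0 \<le> k (x, y)) \<and>
     (\<forall>f\<in>L2_space M. AE x in M.
        integrable M (\<lambda>y. complex_of_real (k (x, y)) * f y) \<and>
        K f x = (\<integral>y. complex_of_real (k (x, y)) * f y \<partial>M))"

definition positive_kernel_operator ::
    "'a measure \<Rightarrow> (('a \<Rightarrow> complex) \<Rightarrow> ('a \<Rightarrow> complex)) \<Rightarrow> bool" where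
  "positive_kernel_operator M K \<longleftrightarrow>
     L2_bounded_operator M K \<and> (\<exists>k. is_kernel_of M k K)"

definition kernel_operator ::
    "'a measure \<Rightarrow> ('a \<times> 'a \<Rightarrow> real) \<Rightarrow> ('a \<Rightarrow> complex) \<Rightarrow> ('a \<Rightarrow> complex)" where
  "kernel_operator M k f = (\<lambda>x. \<integral>y. complex_of_real (k (x, y)) * f y \<partial>M)"

text \<open>
  On a \<open>\<sigma>\<close>-finite measure space the kernel of a positive kernel operator is unique up to
  almost everywhere equality, so the choice of kernel changes the geometric symmetrization
  only up to almost everywhere equality.
\<close>

definition geometric_symmetrization ::
    "'a measure \<Rightarrow> (('a \<Rightarrow> complex) \<Rightarrow> ('a \<Rightarrow> complex)) \<Rightarrow> ('a \<Rightarrow> complex) \<Rightarrow> ('a \<Rightarrow> complex)" where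
  "geometric_symmetrization M K =
     (let k = (SOME k. is_kernel_of M k K)
      in kernel_operator M (\<lambda>(x, y). sqrt (k (x, y) * k (y, x))))"

definition rho ::
    "'a measure \<Rightarrow> (('a \<Rightarrow> complex) \<Rightarrow> ('a \<Rightarrow> complex)) \<Rightarrow> nat \<Rightarrow> real" where
  "rho M K n =
     L2_spectral_radius M (geometric_symmetrization M (K ^^ (2 ^ n))) powr (1 / 2 ^ n)"

end

theory Submission
  imports Defs "HOL-Library.Complex_Order"
begin

text \<open>
  Write \<open>r\<close> for the spectral radius, \<open>S(T)\<close> for the geometric symmetrization of a positive
  kernel operator \<open>T\<close> with kernel \<open>k\<close>, and \<open>s\<close> for the kernel of \<open>S(T)\<close>.  Two
  applications of the Cauchy-Schwarz inequality carry the argument.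

  In the integral \<open>\<integral> s(x,z) s(z,y) dz\<close> regroup the four factors under the square roots into
  \<open>k(x,z) k(z,y)\<close> and \<open>k(y,z) k(z,x)\<close>.  Cauchy-Schwarz bounds the integral by the geometric
  mean of the kernel of \<open>T\<^sup>2\<close> at \<open>(x,y)\<close> and at \<open>(y,x)\<close>.  So \<open>S(T)\<^sup>2 \<le> S(T\<^sup>2)\<close> on
  nonnegative functions (\<open>geometric_symmetrization_square_le\<close>), the same holds for all powers, and
  taking spectral radii gives \<open>r(S(T))\<^sup>2 \<le> r(S(T\<^sup>2))\<close>.  With \<open>T = K ^^ 2 ^ i\<close> this says that
  \<open>\<rho>\<close> increases.

  For the upper bound, let \<open>f \<ge> 0\<close>.  Cauchy-Schwarz in the integral defining \<open>S(T) f\<close> gives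
  \<open>(S(T) f)\<^sup>2 \<le> (T f) (T\<^sup>* f)\<close> pointwise, so that \<open>\<parallel>S(T) f\<parallel>\<^sup>2 \<le> \<langle>T\<^sup>2 f, f\<rangle> \<le> \<parallel>T\<^sup>2\<parallel> \<parallel>f\<parallel>\<^sup>2\<close>
  (\<open>geometric_mean_kernel_int_bound\<close>).  Hence \<open>\<rho>\<^sub>j \<le> \<parallel>K ^^ 2 ^ (j + 1)\<parallel>\<close> to the power
  \<open>1 / 2 ^ (j + 1)\<close>, and the right-hand side tends to \<open>r(K)\<close>.  Since \<open>\<rho>\<close> increases,
  every \<open>\<rho>\<^sub>n\<close> is at most \<open>r(K)\<close>.

  Both steps compare the spectral radius with norms of powers, that is, they use Gelfand's
  formula.  One half is the Neumann series (\<open>spectral_radius_le\<close>).  The other half rests, for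
  positive operators, on an order argument (\<open>positive_operator_power_bound\<close>): if the growth rate
  \<open>g\<close> of the norms of the powers of \<open>T\<close> exceeded \<open>r(T)\<close>, then \<open>g\<close> would lie outside the
  spectrum, so the partial sums of \<open>\<Sum> T ^^ i f / g ^ i\<close> would be bounded uniformly, say by
  \<open>D \<parallel>f\<parallel>\<close> for \<open>f \<ge> 0\<close>.  Applying a partial sum twice collects \<open>m + 1\<close> copies of
  \<open>T ^^ m f / g ^ m\<close>, so \<open>(m + 1) \<parallel>T ^^ m\<parallel> \<le> D\<^sup>2 g ^ m\<close>, and for large \<open>m\<close> this
  contradicts the choice of \<open>g\<close>.
\<close>

section \<open>Square-integrable functions\<close>

lemma ennreal_power2_le_imp_le:
  assumes "a\<^sup>2 \<le> (ennreal b)\<^sup>2" "0 \<le> b"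
  shows "a \<le> ennreal b"
proof (cases a)
  case (real r)
  then show ?thesis
    using assms by (auto simp: ennreal_power intro!: ennreal_leI power2_le_imp_le[of r b])
next
  case top
  then show ?thesis
    using assms by (simp add: ennreal_power power2_eq_square[of top] top_unique)
qed

lemma L2_norm_nonneg [simp]: "0 \<le> L2_norm M f"
  by (simp add: L2_norm_def)

lemma L2_measurable: "f \<in> L2_space M \<Longrightarrow> f \<in> borel_measurable M"
  by (simp add: L2_space_def)

lemma nn_integral_L2_norm:
  assumes "f \<in> L2_space M"
  shows "(\<integral>\<^sup>+x. (ennreal (cmod (f x)))\<^sup>2 \<partial>M) = ennreal ((L2_norm M f)\<^sup>2)"
proof -
  have "(\<integral>\<^sup>+x. ennreal ((cmod (f x))\<^sup>2) \<partial>M) = ennreal (\<integral>x. (cmod (f x))\<^sup>2 \<partial>M)"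
    using assms by (intro nn_integral_eq_integral) (auto simp: L2_space_def)
  then show ?thesis
    by (simp add: L2_norm_def ennreal_power)
qed

lemma L2_spaceI:
  assumes "f \<in> borel_measurable M" "0 \<le> A"
    and "(\<integral>\<^sup>+x. (ennreal (cmod (f x)))\<^sup>2 \<partial>M) \<le> ennreal (A\<^sup>2)"
  shows "f \<in> L2_space M" "L2_norm M f \<le> A"
proof -
  have le: "(\<integral>\<^sup>+x. ennreal ((cmod (f x))\<^sup>2) \<partial>M) \<le> ennreal (A\<^sup>2)"
    using assms(3) by (simp add: ennreal_power)
  have "integrable M (\<lambda>x. (cmod (f x))\<^sup>2)"
    using assms(1) le by (intro integrableI_bounded) (auto simp: le_less_trans)
  then show f: "f \<in> L2_space M"
    using assms(1) by (simp add: L2_space_def)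
  have "(L2_norm M f)\<^sup>2 \<le> A\<^sup>2"
    using nn_integral_L2_norm[OF f] assms(3) by (simp add: ennreal_le_iff)
  then show "L2_norm M f \<le> A"
    using assms(2) by (rule power2_le_imp_le)
qed

lemma L2_dominated:
  assumes "f \<in> borel_measurable M" "g \<in> L2_space M" "AE x in M. cmod (f x) \<le> cmod (g x)"
  shows "f \<in> L2_space M" "L2_norm M f \<le> L2_norm M g"
proof -
  have "(\<integral>\<^sup>+x. (ennreal (cmod (f x)))\<^sup>2 \<partial>M) \<le> (\<integral>\<^sup>+x. (ennreal (cmod (g x)))\<^sup>2 \<partial>M)"
    using assms(3) by (intro nn_integral_mono_AE) (auto elim!: eventually_mono intro!: power_mono ennreal_leI)
  then have "(\<integral>\<^sup>+x. (ennreal (cmod (f x)))\<^sup>2 \<partial>M) \<le> ennreal ((L2_norm M g)\<^sup>2)"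
    by (simp add: nn_integral_L2_norm[OF assms(2)])
  then show "f \<in> L2_space M" "L2_norm M f \<le> L2_norm M g"
    using L2_spaceI[OF assms(1), of "L2_norm M g"] by simp_all
qed

lemma L2_norm_AE_cong:
  assumes "f \<in> L2_space M" "g \<in> L2_space M" "AE x in M. f x = g x"
  shows "L2_norm M f = L2_norm M g"
proof -
  have "L2_norm M f \<le> L2_norm M g"
    using assms by (intro L2_dominated(2)) (auto simp: L2_measurable elim!: eventually_mono)
  moreover have "L2_norm M g \<le> L2_norm M f"
    using assms by (intro L2_dominated(2)) (auto simp: L2_measurable elim!: eventually_mono)
  ultimately show ?thesis by simp
qed

lemma L2_norm_eq_0D:
  assumes "f \<in> L2_space M" "L2_norm M f = 0"
  shows "AE x in M. f x = 0"
proof -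
  have "(\<integral>\<^sup>+x. (ennreal (cmod (f x)))\<^sup>2 \<partial>M) = 0"
    using nn_integral_L2_norm[OF assms(1)] assms(2) by simp
  then have "AE x in M. (ennreal (cmod (f x)))\<^sup>2 = 0"
    using assms(1) by (subst (asm) nn_integral_0_iff_AE) (auto simp: L2_space_def)
  then show ?thesis
    by (auto elim!: eventually_mono)
qed

lemma L2_Cauchy_Schwarz:
  assumes f: "f \<in> L2_space M" and g: "g \<in> L2_space M"
  shows "(\<integral>\<^sup>+x. ennreal (cmod (f x)) * ennreal (cmod (g x)) \<partial>M) \<le> ennreal (L2_norm M f * L2_norm M g)"
proof -
  let ?I = "\<integral>\<^sup>+x. ennreal (cmod (f x)) * ennreal (cmod (g x)) \<partial>M"
  have "?I\<^sup>2 \<le> (\<integral>\<^sup>+x. (ennreal (cmod (f x)))\<^sup>2 \<partial>M) * (\<integral>\<^sup>+x. (ennreal (cmod (g x)))\<^sup>2 \<partial>M)"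
    using f g by (intro Cauchy_Schwarz_nn_integral) (auto simp: L2_space_def)
  also have "\<dots> = (ennreal (L2_norm M f * L2_norm M g))\<^sup>2"
    unfolding nn_integral_L2_norm[OF f] nn_integral_L2_norm[OF g]
    by (simp add: ennreal_power power_mult_distrib flip: ennreal_mult)
  finally show ?thesis
    by (rule ennreal_power2_le_imp_le) simp
qed

lemma L2_add:
  assumes f: "f \<in> L2_space M" and g: "g \<in> L2_space M"
  shows "(\<lambda>x. f x + g x) \<in> L2_space M"
    and "L2_norm M (\<lambda>x. f x + g x) \<le> L2_norm M f + L2_norm M g"
proof -
  note [measurable] = L2_measurable[OF f] L2_measurable[OF g]
  let ?a = "\<lambda>x. ennreal (cmod (f x))" and ?b = "\<lambda>x. ennreal (cmod (g x))"
  have "(\<integral>\<^sup>+x. (ennreal (cmod (f x + g x)))\<^sup>2 \<partial>M) \<le> (\<integral>\<^sup>+x. ((?a x)\<^sup>2 + 2 * (?a x * ?b x)) + (?b x)\<^sup>2 \<partial>M)"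
  proof (intro nn_integral_mono)
    fix x
    have "(ennreal (cmod (f x + g x)))\<^sup>2 \<le> (?a x + ?b x)\<^sup>2"
      by (intro power_mono) (auto simp: norm_triangle_ineq simp flip: ennreal_plus)
    also have "\<dots> = ((?a x)\<^sup>2 + 2 * (?a x * ?b x)) + (?b x)\<^sup>2"
      by (simp add: power2_sum algebra_simps)
    finally show "(ennreal (cmod (f x + g x)))\<^sup>2 \<le> ((?a x)\<^sup>2 + 2 * (?a x * ?b x)) + (?b x)\<^sup>2" .
  qed
  also have "\<dots> = ennreal ((L2_norm M f)\<^sup>2) + 2 * (\<integral>\<^sup>+x. ?a x * ?b x \<partial>M) + ennreal ((L2_norm M g)\<^sup>2)"
    by (simp add: nn_integral_add nn_integral_cmult nn_integral_L2_norm f g)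
  also have "\<dots> \<le> ennreal ((L2_norm M f)\<^sup>2) + 2 * ennreal (L2_norm M f * L2_norm M g) + ennreal ((L2_norm M g)\<^sup>2)"
    by (intro add_mono mult_left_mono L2_Cauchy_Schwarz f g) auto
  also have "\<dots> = ennreal ((L2_norm M f + L2_norm M g)\<^sup>2)"
  proof -
    have "2 * ennreal (L2_norm M f * L2_norm M g) = ennreal (2 * (L2_norm M f * L2_norm M g))"
      by (simp add: ennreal_mult)
    then show ?thesis
      by (simp add: power2_sum algebra_simps flip: ennreal_plus)
  qed
  finally have le: "(\<integral>\<^sup>+x. (ennreal (cmod (f x + g x)))\<^sup>2 \<partial>M) \<le> ennreal ((L2_norm M f + L2_norm M g)\<^sup>2)" .
  show "(\<lambda>x. f x + g x) \<in> L2_space M" "L2_norm M (\<lambda>x. f x + g x) \<le> L2_norm M f + L2_norm M g"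
    using L2_spaceI[OF _ _ le] by simp_all
qed

lemma L2_scale:
  assumes f: "f \<in> L2_space M"
  shows "(\<lambda>x. c * f x) \<in> L2_space M" and "L2_norm M (\<lambda>x. c * f x) = cmod c * L2_norm M f"
proof -
  show "(\<lambda>x. c * f x) \<in> L2_space M"
    using f by (auto simp: L2_space_def norm_mult power_mult_distrib)
  show "L2_norm M (\<lambda>x. c * f x) = cmod c * L2_norm M f"
    by (simp add: L2_norm_def norm_mult power_mult_distrib real_sqrt_mult)
qed

lemma L2_zero: "(\<lambda>x. 0) \<in> L2_space M" "L2_norm M (\<lambda>x. 0) = 0"
  by (simp_all add: L2_space_def L2_norm_def)

lemma L2_diff:
  assumes f: "f \<in> L2_space M" and g: "g \<in> L2_space M"
  shows "(\<lambda>x. f x - g x) \<in> L2_space M"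
    and "L2_norm M (\<lambda>x. f x - g x) \<le> L2_norm M f + L2_norm M g"
  using L2_add[OF f L2_scale(1)[OF g, of "-1"]] L2_scale(2)[OF g, of "-1"] by simp_all

lemma L2_sum:
  assumes "\<And>i. i \<in> I \<Longrightarrow> f i \<in> L2_space M"
  shows "(\<lambda>x. \<Sum>i\<in>I. f i x) \<in> L2_space M"
    and "L2_norm M (\<lambda>x. \<Sum>i\<in>I. f i x) \<le> (\<Sum>i\<in>I. L2_norm M (f i))"
  using assms
proof (induction I rule: infinite_finite_induct)
  case (insert i I)
  { case 1
    then show ?case using insert by (simp add: L2_add) }
  { case 2
    then have "L2_norm M (\<lambda>x. f i x + (\<Sum>i\<in>I. f i x)) \<le> L2_norm M (f i) + L2_norm M (\<lambda>x. \<Sum>i\<in>I. f i x)"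
      using insert by (intro L2_add) auto
    then show ?case using 2 insert by fastforce }
qed (simp_all add: L2_zero)

definition L2_abs :: "('a \<Rightarrow> complex) \<Rightarrow> 'a \<Rightarrow> complex" where
  "L2_abs f = (\<lambda>x. complex_of_real (cmod (f x)))"

lemma L2_abs:
  assumes "f \<in> L2_space M"
  shows "L2_abs f \<in> L2_space M" "L2_norm M (L2_abs f) = L2_norm M f"
  using assms by (auto simp: L2_space_def L2_abs_def L2_norm_def)

text \<open>
  This is the form in which completeness of the Hilbert space enters: a series whose norms are
  summable converges absolutely almost everywhere.  The reason is monotone convergence, applied to
  the squares of the partial sums of the absolute values.
\<close>

lemma L2_series:
  assumes h: "\<And>m. h m \<in> L2_space M" and a: "\<And>m. L2_norm M (h m) \<le> a m" "summable a"
  shows "AE x in M. summable (\<lambda>m. h m x)"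
    and "(\<lambda>x. \<Sum>m. h m x) \<in> L2_space M"
    and "L2_norm M (\<lambda>x. \<Sum>m. h m x) \<le> (\<Sum>m. a m)"
proof -
  note [measurable] = L2_measurable[OF h]
  have a0: "0 \<le> a m" for m using a(1)[of m] L2_norm_nonneg[of M "h m"] by linarith
  let ?A = "\<Sum>m. a m"
  have A0: "0 \<le> ?A" by (intro suminf_nonneg a(2) a0)
  let ?g = "\<lambda>N x. \<Sum>m<N. ennreal (cmod (h m x))"
  let ?G = "\<lambda>x. \<Sum>m. ennreal (cmod (h m x))"
  have part: "(\<integral>\<^sup>+x. (?g N x)\<^sup>2 \<partial>M) \<le> ennreal (?A\<^sup>2)" for N
  proof -
    let ?u = "\<lambda>x. \<Sum>m<N. L2_abs (h m) x"
    have u: "?u \<in> L2_space M" "L2_norm M ?u \<le> (\<Sum>m<N. L2_norm M (L2_abs (h m)))"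
      by (intro L2_sum L2_abs h)+
    have "cmod (?u x) = (\<Sum>m<N. cmod (h m x))" for x
      by (simp add: L2_abs_def sum_nonneg flip: of_real_sum)
    then have "(\<integral>\<^sup>+x. (?g N x)\<^sup>2 \<partial>M) = (\<integral>\<^sup>+x. (ennreal (cmod (?u x)))\<^sup>2 \<partial>M)"
      by (simp add: sum_ennreal)
    also have "\<dots> = ennreal ((L2_norm M ?u)\<^sup>2)"
      by (rule nn_integral_L2_norm[OF u(1)])
    also have "\<dots> \<le> ennreal (?A\<^sup>2)"
    proof (intro ennreal_leI power_mono)
      have "(\<Sum>m<N. L2_norm M (L2_abs (h m))) \<le> (\<Sum>m<N. a m)"
        by (intro sum_mono) (simp add: L2_abs(2) h a)
      also have "\<dots> \<le> ?A"
        by (intro sum_le_suminf a(2)) (auto simp: a0)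
      finally show "L2_norm M ?u \<le> ?A" using u(2) by simp
    qed simp
    finally show ?thesis .
  qed
  have lim: "(?G x)\<^sup>2 = (SUP N. (?g N x)\<^sup>2)" for x
  proof -
    have inc: "incseq (\<lambda>N. ?g N x)"
      by (intro monoI sum_mono2) auto
    have "(\<lambda>N. (?g N x)\<^sup>2) \<longlonglongrightarrow> (?G x)\<^sup>2"
      unfolding power2_eq_square
      by (intro tendsto_mult_ennreal summable_LIMSEQ summableI) (auto simp: zero_less_iff_neq_zero)
    moreover have "incseq (\<lambda>N. (?g N x)\<^sup>2)"
      using inc by (intro monoI power_mono) (auto dest: monoD)
    ultimately show ?thesis
      by (intro LIMSEQ_unique[OF _ LIMSEQ_SUP])
  qed
  have "(\<integral>\<^sup>+x. (?G x)\<^sup>2 \<partial>M) = (SUP N. \<integral>\<^sup>+x. (?g N x)\<^sup>2 \<partial>M)"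
    unfolding lim
    by (intro nn_integral_monotone_convergence_SUP)
       (auto simp: incseq_def le_fun_def intro!: power_mono ennreal_leI sum_mono2)
  also have "\<dots> \<le> ennreal (?A\<^sup>2)"
    by (intro SUP_least part)
  finally have G: "(\<integral>\<^sup>+x. (?G x)\<^sup>2 \<partial>M) \<le> ennreal (?A\<^sup>2)" .
  then have "AE x in M. (?G x)\<^sup>2 \<noteq> \<infinity>"
    by (intro nn_integral_PInf_AE) (auto simp: top_unique)
  then have fin: "AE x in M. summable (\<lambda>m. cmod (h m x)) \<and> ?G x = ennreal (\<Sum>m. cmod (h m x))"
  proof (rule eventually_mono)
    fix x assume "(?G x)\<^sup>2 \<noteq> \<infinity>"
    then have "?G x \<noteq> top"
      by (auto simp: power2_eq_square ennreal_top_mult)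
    then have "summable (\<lambda>m. cmod (h m x))"
      by (intro summable_suminf_not_top) auto
    then show "summable (\<lambda>m. cmod (h m x)) \<and> ?G x = ennreal (\<Sum>m. cmod (h m x))"
      by (auto intro!: suminf_ennreal2)
  qed
  then show "AE x in M. summable (\<lambda>m. h m x)"
    by (rule eventually_mono) (auto intro: summable_norm_cancel)
  have "AE x in M. (ennreal (cmod (\<Sum>m. h m x)))\<^sup>2 \<le> (?G x)\<^sup>2"
    using fin by (rule eventually_mono) (auto intro!: power_mono ennreal_leI summable_norm)
  then have "(\<integral>\<^sup>+x. (ennreal (cmod (\<Sum>m. h m x)))\<^sup>2 \<partial>M) \<le> ennreal (?A\<^sup>2)"
    by (rule order_trans[OF nn_integral_mono_AE G])
  then show "(\<lambda>x. \<Sum>m. h m x) \<in> L2_space M" "L2_norm M (\<lambda>x. \<Sum>m. h m x) \<le> ?A"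
    using A0 by (auto intro!: L2_spaceI)
qed

section \<open>Bounded operators and the Neumann series\<close>

definition L2_bound :: "'a measure \<Rightarrow> (('a \<Rightarrow> complex) \<Rightarrow> ('a \<Rightarrow> complex)) \<Rightarrow> real \<Rightarrow> bool" where
  "L2_bound M T C \<longleftrightarrow> (\<forall>f\<in>L2_space M. L2_norm M (T f) \<le> C * L2_norm M f)"

lemma L2_boundD: "L2_bound M T C \<Longrightarrow> f \<in> L2_space M \<Longrightarrow> L2_norm M (T f) \<le> C * L2_norm M f"
  by (simp add: L2_bound_def)

lemma L2_bound_mono: "L2_bound M T C \<Longrightarrow> C \<le> D \<Longrightarrow> L2_bound M T D"
  unfolding L2_bound_def by (meson L2_norm_nonneg mult_right_mono order_trans)

context
  fixes M :: "'a measure" and T :: "('a \<Rightarrow> complex) \<Rightarrow> ('a \<Rightarrow> complex)"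
  assumes op: "L2_bounded_operator M T"
begin

lemma operator_closed: "f \<in> L2_space M \<Longrightarrow> T f \<in> L2_space M"
  using op by (simp add: L2_bounded_operator_def)

lemma operator_cong:
  "f \<in> L2_space M \<Longrightarrow> g \<in> L2_space M \<Longrightarrow> AE x in M. f x = g x \<Longrightarrow> AE x in M. T f x = T g x"
  using op by (simp add: L2_bounded_operator_def)

lemma operator_add:
  "f \<in> L2_space M \<Longrightarrow> g \<in> L2_space M \<Longrightarrow> AE x in M. T (\<lambda>y. f y + g y) x = T f x + T g x"
  using op by (simp add: L2_bounded_operator_def)

lemma operator_scale: "f \<in> L2_space M \<Longrightarrow> AE x in M. T (\<lambda>y. c * f y) x = c * T f x"
  using op by (simp add: L2_bounded_operator_def)

lemma operator_bound: obtains C where "0 < C" "L2_bound M T C"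
proof -
  obtain C where "\<forall>f\<in>L2_space M. L2_norm M (T f) \<le> C * L2_norm M f"
    using op by (auto simp: L2_bounded_operator_def)
  then have "L2_bound M T C" by (simp add: L2_bound_def)
  then show ?thesis
    using that[of "max C 1"] L2_bound_mono[of M T C "max C 1"] by auto
qed

lemma operator_diff:
  assumes "f \<in> L2_space M" "g \<in> L2_space M"
  shows "AE x in M. T (\<lambda>y. f y - g y) x = T f x - T g x"
  using operator_add[OF assms(1) L2_scale(1)[OF assms(2), of "-1"]] operator_scale[OF assms(2), of "-1"]
  by eventually_elim simp

lemma operator_sum:
  assumes "finite I" "\<And>i. i \<in> I \<Longrightarrow> f i \<in> L2_space M"
  shows "AE x in M. T (\<lambda>y. \<Sum>i\<in>I. f i y) x = (\<Sum>i\<in>I. T (f i) x)"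
  using assms
proof (induction I rule: finite_induct)
  case empty
  then show ?case
    using operator_scale[OF L2_zero(1), of 0] by simp
next
  case (insert i I)
  have "AE x in M. T (\<lambda>y. \<Sum>i\<in>I. f i y) x = (\<Sum>i\<in>I. T (f i) x)"
    using insert by simp
  moreover have "AE x in M. T (\<lambda>y. f i y + (\<Sum>i\<in>I. f i y)) x = T (f i) x + T (\<lambda>y. \<Sum>i\<in>I. f i y) x"
    using insert by (intro operator_add L2_sum(1)) auto
  ultimately have "AE x in M. T (\<lambda>y. f i y + (\<Sum>i\<in>I. f i y)) x = T (f i) x + (\<Sum>i\<in>I. T (f i) x)"
    by eventually_elim simp
  then show ?case
    using insert(1,2) by simp
qed

text \<open>
  The two sides differ by the image of a tail minus the tail of the images, for every cut-off,
  and both tails tend to zero in norm.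
\<close>

lemma operator_suminf:
  assumes h: "\<And>m. h m \<in> L2_space M" and a: "\<And>m. L2_norm M (h m) \<le> a m" "summable a"
  shows "AE x in M. T (\<lambda>y. \<Sum>m. h m y) x = (\<Sum>m. T (h m) x)"
proof -
  obtain C where C: "0 < C" "L2_bound M T C" by (rule operator_bound)
  have Th: "\<And>m. T (h m) \<in> L2_space M" by (simp add: operator_closed h)
  have Ca: "L2_norm M (T (h m)) \<le> C * a m" for m
    using L2_boundD[OF C(2) h[of m]] a(1)[of m] C(1) by (meson mult_left_mono less_imp_le order_trans)
  have sCa: "summable (\<lambda>m. C * a m)" by (intro summable_mult a(2))
  let ?u = "\<lambda>x. \<Sum>m. h m x" and ?v = "\<lambda>x. \<Sum>m. T (h m) x"
  note hs = L2_series[OF h a] and Ths = L2_series[OF Th Ca sCa]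
  have Tu: "T ?u \<in> L2_space M" by (intro operator_closed hs)
  let ?d = "\<lambda>x. T ?u x - ?v x"
  have d: "?d \<in> L2_space M" by (intro L2_diff Tu Ths)
  have tail: "L2_norm M ?d \<le> 2 * C * (\<Sum>m. a (m + N))" for N
  proof -
    have aN: "summable (\<lambda>m. a (m + N))" using a(2) by (subst summable_iff_shift)
    have CaN: "summable (\<lambda>m. C * a (m + N))" by (intro summable_mult aN)
    let ?uN = "\<lambda>x. \<Sum>m. h (m + N) x" and ?vN = "\<lambda>x. \<Sum>m. T (h (m + N)) x"
    let ?s = "\<lambda>x. \<Sum>m<N. h m x"
    note uN = L2_series[OF h[of "_ + N"] a(1)[of "_ + N"] aN]
    note vN = L2_series[OF Th[of "_ + N"] Ca[of "_ + N"] CaN]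
    have s: "?s \<in> L2_space M" by (intro L2_sum h)
    have "AE x in M. ?u x = ?s x + ?uN x"
      using hs(1) by eventually_elim (subst suminf_split_initial_segment[of _ N], auto)
    then have "AE x in M. T ?u x = T (\<lambda>x. ?s x + ?uN x) x"
      by (intro operator_cong hs L2_add s uN)
    moreover have "AE x in M. T (\<lambda>x. ?s x + ?uN x) x = T ?s x + T ?uN x"
      by (intro operator_add s uN)
    moreover have "AE x in M. T ?s x = (\<Sum>m<N. T (h m) x)"
      by (intro operator_sum h) auto
    moreover have "AE x in M. ?v x = (\<Sum>m<N. T (h m) x) + ?vN x"
      using Ths(1) by eventually_elim (subst suminf_split_initial_segment[of _ N], auto)
    ultimately have "AE x in M. ?d x = T ?uN x - ?vN x"
      by eventually_elim simp
    then have "L2_norm M ?d = L2_norm M (\<lambda>x. T ?uN x - ?vN x)"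
      by (intro L2_norm_AE_cong d L2_diff operator_closed uN vN)
    also have "\<dots> \<le> L2_norm M (T ?uN) + L2_norm M ?vN"
      by (intro L2_diff operator_closed uN vN)
    also have "\<dots> \<le> C * (\<Sum>m. a (m + N)) + (\<Sum>m. C * a (m + N))"
    proof (intro add_mono)
      have "L2_norm M (T ?uN) \<le> C * L2_norm M ?uN" by (intro L2_boundD[OF C(2)] uN)
      also have "\<dots> \<le> C * (\<Sum>m. a (m + N))" using C(1) by (intro mult_left_mono uN) auto
      finally show "L2_norm M (T ?uN) \<le> C * (\<Sum>m. a (m + N))" .
    qed (rule vN)
    also have "\<dots> = 2 * C * (\<Sum>m. a (m + N))"
      by (simp add: suminf_mult[OF aN])
    finally show ?thesis .
  qed
  have "L2_norm M ?d \<le> 0"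
  proof (rule field_le_epsilon)
    fix e :: real assume "0 < e"
    then obtain N where "\<forall>n\<ge>N. norm (\<Sum>i. a (i + n)) < e / (2 * C)"
      using suminf_exist_split[of "e / (2 * C)" a] a(2) C(1) by auto
    then have "(\<Sum>i. a (i + N)) < e / (2 * C)" by (auto simp: abs_less_iff)
    then have "2 * C * (\<Sum>i. a (i + N)) \<le> e" using C(1) by (simp add: field_simps)
    then show "L2_norm M ?d \<le> 0 + e" using tail[of N] by simp
  qed
  then have "L2_norm M ?d = 0" by (simp add: order_antisym)
  from L2_norm_eq_0D[OF d this] show ?thesis by eventually_elim simp
qed

end

lemma operator_compose:
  assumes T: "L2_bounded_operator M T" and U: "L2_bounded_operator M U"
  shows "L2_bounded_operator M (T \<circ> U)"
  unfolding L2_bounded_operator_def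
proof (intro conjI ballI impI allI)
  note Uc = operator_closed[OF U] and Tc = operator_closed[OF T]
  show "(T \<circ> U) f \<in> L2_space M" if "f \<in> L2_space M" for f
    using that by (simp add: Uc Tc)
  show "AE x in M. (T \<circ> U) f x = (T \<circ> U) g x"
    if "f \<in> L2_space M" "g \<in> L2_space M" "AE x in M. f x = g x" for f g
    using operator_cong[OF T Uc Uc operator_cong[OF U that]] that by simp
  show "AE x in M. (T \<circ> U) (\<lambda>y. f y + g y) x = (T \<circ> U) f x + (T \<circ> U) g x"
    if f: "f \<in> L2_space M" and g: "g \<in> L2_space M" for f g
  proof -
    have "AE x in M. T (U (\<lambda>y. f y + g y)) x = T (\<lambda>y. U f y + U g y) x"
      by (intro operator_cong[OF T] operator_add[OF U] L2_add Uc f g)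
    with operator_add[OF T Uc[OF f] Uc[OF g]] show ?thesis by eventually_elim simp
  qed
  show "AE x in M. (T \<circ> U) (\<lambda>y. c * f y) x = c * (T \<circ> U) f x"
    if f: "f \<in> L2_space M" for c f
  proof -
    have "AE x in M. T (U (\<lambda>y. c * f y)) x = T (\<lambda>y. c * U f y) x"
      by (intro operator_cong[OF T] operator_scale[OF U] L2_scale Uc f)
    with operator_scale[OF T Uc[OF f], of c] show ?thesis by eventually_elim simp
  qed
  obtain C D where C: "0 < C" "L2_bound M T C" and D: "0 < D" "L2_bound M U D"
    using operator_bound[OF T] operator_bound[OF U] by metis
  have "L2_norm M ((T \<circ> U) f) \<le> C * D * L2_norm M f" if f: "f \<in> L2_space M" for f
  proof -
    have "L2_norm M (T (U f)) \<le> C * L2_norm M (U f)" by (rule L2_boundD[OF C(2) Uc[OF f]])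
    also have "\<dots> \<le> C * (D * L2_norm M f)" using C(1) by (intro mult_left_mono L2_boundD[OF D(2) f]) auto
    finally show ?thesis by (simp add: mult.assoc)
  qed
  then show "\<exists>C. \<forall>f\<in>L2_space M. L2_norm M ((T \<circ> U) f) \<le> C * L2_norm M f" by blast
qed

lemma operator_funpow:
  assumes "L2_bounded_operator M T"
  shows "L2_bounded_operator M (T ^^ m)"
proof (induction m)
  case 0
  show ?case by (auto simp: L2_bounded_operator_def intro!: exI[of _ 1])
next
  case (Suc m)
  then show ?case using operator_compose[OF assms Suc] by (simp add: comp_def)
qed

lemma L2_bound_funpow:
  assumes op: "L2_bounded_operator M T" and C: "0 \<le> C" "L2_bound M T C"
  shows "L2_bound M (T ^^ m) (C ^ m)"
proof (induction m)
  case (Suc m)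
  show ?case
    unfolding L2_bound_def
  proof
    fix f assume f: "f \<in> L2_space M"
    have "L2_norm M (T ((T ^^ m) f)) \<le> C * L2_norm M ((T ^^ m) f)"
      by (intro L2_boundD[OF C(2)] operator_closed[OF operator_funpow[OF op]] f)
    also have "\<dots> \<le> C * (C ^ m * L2_norm M f)"
      by (intro mult_left_mono L2_boundD[OF Suc f] C)
    finally show "L2_norm M ((T ^^ Suc m) f) \<le> C ^ Suc m * L2_norm M f"
      by (simp add: mult.assoc)
  qed
qed (simp add: L2_bound_def)

text \<open>
  Divide an exponent by \<open>m\<close>: the bound on the \<open>m\<close>-th power handles the quotient, and the
  remainder, which is less than \<open>m\<close>, contributes only the constant.  A growth rate of the powers
  can thus be read off from a single power.
\<close>

lemma power_bound_all:
  assumes op: "L2_bounded_operator M T" and m: "0 < m" and t: "0 < t"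
    and b: "L2_bound M (T ^^ m) (t ^ m)"
  obtains B where "0 < B" "\<And>n. L2_bound M (T ^^ n) (B * t ^ n)"
proof -
  obtain C where C: "0 < C" "L2_bound M T C" by (rule operator_bound[OF op])
  define q where "q = max 1 (C / t)"
  have "L2_bound M (T ^^ n) (q ^ m * t ^ n)" for n
    unfolding L2_bound_def
  proof
    fix f assume f: "f \<in> L2_space M"
    let ?s = "n mod m" and ?q = "n div m"
    let ?h = "(T ^^ (m * ?q)) f"
    have "n = ?s + m * ?q" by simp
    then have "(T ^^ n) f = (T ^^ ?s) ?h"
      by (metis comp_apply funpow_add)
    then have "L2_norm M ((T ^^ n) f) \<le> C ^ ?s * L2_norm M ?h"
      using C by (auto intro!: L2_boundD[OF L2_bound_funpow[OF op]] operator_closed[OF operator_funpow[OF op]] f)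
    also have "\<dots> \<le> C ^ ?s * ((t ^ m) ^ ?q * L2_norm M f)"
    proof (intro mult_left_mono)
      show "L2_norm M ?h \<le> (t ^ m) ^ ?q * L2_norm M f"
        using L2_boundD[OF L2_bound_funpow[OF operator_funpow[OF op] _ b, of ?q] f] t
        by (simp add: funpow_mult)
    qed (use C in auto)
    also have "\<dots> \<le> (q ^ m * t ^ ?s) * ((t ^ m) ^ ?q * L2_norm M f)"
    proof (intro mult_right_mono)
      have "C ^ ?s = (C / t) ^ ?s * t ^ ?s" using t by (simp add: power_divide)
      also have "(C / t) ^ ?s \<le> q ^ ?s"
        using C t by (intro power_mono) (auto simp: q_def)
      also have "q ^ ?s \<le> q ^ m"
        using m by (intro power_increasing) (auto simp: q_def)
      finally show "C ^ ?s \<le> q ^ m * t ^ ?s" using t by simp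
    qed (use t in auto)
    also have "\<dots> = q ^ m * t ^ (?s + m * ?q) * L2_norm M f"
      by (simp only: power_add power_mult mult.assoc)
    finally show "L2_norm M ((T ^^ n) f) \<le> q ^ m * t ^ n * L2_norm M f" by simp
  qed
  moreover have "0 < q ^ m" by (simp add: q_def less_max_iff_disj)
  ultimately show ?thesis using that by blast
qed

text \<open>
  The inverse of \<open>T - c\<close> is \<open>- \<Sum> T ^^ m / c ^ (m + 1)\<close>, summed pointwise almost everywhere.
\<close>

lemma Neumann_series:
  assumes op: "L2_bounded_operator M T" and t: "0 < t" "t < cmod c" and B: "0 < B"
    and pb: "\<And>n. L2_bound M (T ^^ n) (B * t ^ n)"
  shows "c \<notin> L2_spectrum M T"
proof -
  have c0: "c \<noteq> 0" using t by auto
  note pop = operator_funpow[OF op]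
  define h where "h f m = (\<lambda>x. inverse (c ^ Suc m) * (T ^^ m) f x)" for f m
  define b where "b m = B / cmod c * (t / cmod c) ^ m" for m
  have sb: "summable b"
    unfolding b_def using t by (intro summable_mult summable_geometric) (auto simp: divide_less_eq)
  have h: "h f m \<in> L2_space M" if "f \<in> L2_space M" for f m
    unfolding h_def using that by (intro L2_scale operator_closed[OF pop])
  have hb: "L2_norm M (h f m) \<le> b m * L2_norm M f" if f: "f \<in> L2_space M" for f m
  proof -
    have "L2_norm M (h f m) = inverse (cmod c ^ Suc m) * L2_norm M ((T ^^ m) f)"
      unfolding h_def using f by (subst L2_scale(2)) (auto simp: operator_closed[OF pop] norm_inverse norm_mult norm_power)
    also have "\<dots> \<le> inverse (cmod c ^ Suc m) * (B * t ^ m * L2_norm M f)"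
      by (intro mult_left_mono L2_boundD[OF pb f]) simp
    also have "\<dots> = b m * L2_norm M f"
      by (simp add: b_def field_simps)
    finally show ?thesis .
  qed
  have sbf: "summable (\<lambda>m. b m * L2_norm M f)" for f
    by (intro summable_mult2 sb)
  have ser: "AE x in M. summable (\<lambda>m. h f m x)" "(\<lambda>x. \<Sum>m. h f m x) \<in> L2_space M"
      "L2_norm M (\<lambda>x. \<Sum>m. h f m x) \<le> (\<Sum>m. b m * L2_norm M f)" if f: "f \<in> L2_space M" for f
    using L2_series[OF h[OF f] hb[OF f] sbf] by auto
  define R where "R f = (\<lambda>x. - 1 * (\<Sum>m. h f m x))" for f
  have Rc: "R f \<in> L2_space M" if "f \<in> L2_space M" for f
    unfolding R_def using that by (intro L2_scale ser)
  have Rop: "L2_bounded_operator M R"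
    unfolding L2_bounded_operator_def
  proof (intro conjI ballI allI impI)
    show "AE x in M. R f x = R g x"
      if "f \<in> L2_space M" "g \<in> L2_space M" "AE x in M. f x = g x" for f g
    proof -
      have "AE x in M. \<forall>m. (T ^^ m) f x = (T ^^ m) g x"
        unfolding AE_all_countable using operator_cong[OF pop that] by blast
      then show ?thesis by eventually_elim (simp add: R_def h_def)
    qed
    show "AE x in M. R (\<lambda>y. f y + g y) x = R f x + R g x"
      if fg: "f \<in> L2_space M" "g \<in> L2_space M" for f g
    proof -
      have "AE x in M. \<forall>m. (T ^^ m) (\<lambda>y. f y + g y) x = (T ^^ m) f x + (T ^^ m) g x"
        unfolding AE_all_countable using operator_add[OF pop fg] by blast
      with ser(1)[OF fg(1)] ser(1)[OF fg(2)] show ?thesis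
      proof eventually_elim
        case (elim x)
        then have "h (\<lambda>y. f y + g y) m x = h f m x + h g m x" for m
          by (simp add: h_def ring_distribs)
        then show ?case
          using suminf_add[OF elim(1,2), symmetric] by (simp add: R_def)
      qed
    qed
    show "AE x in M. R (\<lambda>y. d * f y) x = d * R f x" if f: "f \<in> L2_space M" for d f
    proof -
      have "AE x in M. \<forall>m. (T ^^ m) (\<lambda>y. d * f y) x = d * (T ^^ m) f x"
        unfolding AE_all_countable using operator_scale[OF pop f] by blast
      with ser(1)[OF f] show ?thesis
      proof eventually_elim
        case (elim x)
        then have "h (\<lambda>y. d * f y) m x = d * h f m x" for m
          by (simp add: h_def)
        then show ?case
          using suminf_mult[OF elim(1), of d] by (simp add: R_def)
      qed
    qed
    show "\<exists>C. \<forall>f\<in>L2_space M. L2_norm M (R f) \<le> C * L2_norm M f"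
    proof (intro exI ballI)
      fix f assume f: "f \<in> L2_space M"
      have "L2_norm M (R f) = L2_norm M (\<lambda>x. \<Sum>m. h f m x)"
        unfolding R_def by (subst L2_scale(2)) (use ser f in auto)
      also have "\<dots> \<le> (\<Sum>m. b m) * L2_norm M f"
        using ser(3)[OF f] suminf_mult2[OF sb] by simp
      finally show "L2_norm M (R f) \<le> (\<Sum>m. b m) * L2_norm M f" .
    qed
  qed (rule Rc)
  have left: "AE x in M. R (\<lambda>y. T f y - c * f y) x = f x" if f: "f \<in> L2_space M" for f
  proof -
    have Tf: "T f \<in> L2_space M" by (intro operator_closed[OF op] f)
    have cf: "(\<lambda>y. c * f y) \<in> L2_space M" by (intro L2_scale f)
    have "AE x in M. \<forall>m. (T ^^ m) (\<lambda>y. T f y - c * f y) x = (T ^^ Suc m) f x - c * (T ^^ m) f x"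
      unfolding AE_all_countable
    proof
      fix m
      show "AE x in M. (T ^^ m) (\<lambda>y. T f y - c * f y) x = (T ^^ Suc m) f x - c * (T ^^ m) f x"
        using operator_diff[OF pop[of m] Tf cf] operator_scale[OF pop[of m] f, of c]
        by eventually_elim (simp add: funpow_swap1)
    qed
    with ser(1)[OF f] show ?thesis
    proof eventually_elim
      case (elim x)
      have "h (\<lambda>y. T f y - c * f y) m x = c * h f (Suc m) x - c * h f m x" for m
        using elim(2) c0 by (simp add: h_def field_simps)
      moreover have "(\<lambda>m. c * h f (Suc m) x - c * h f m x) sums (0 - c * h f 0 x)"
        using tendsto_mult_right_zero[OF summable_LIMSEQ_zero[OF elim(1)]] by (intro telescope_sums)
      ultimately have "(\<Sum>m. h (\<lambda>y. T f y - c * f y) m x) = - (c * h f 0 x)"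
        by (simp add: sums_iff)
      then show ?case using c0 by (simp add: R_def h_def)
    qed
  qed
  have right: "AE x in M. T (R f) x - c * R f x = f x" if f: "f \<in> L2_space M" for f
  proof -
    have "AE x in M. T (R f) x = - 1 * T (\<lambda>x. \<Sum>m. h f m x) x"
      unfolding R_def by (intro operator_scale[OF op] ser f)
    moreover have "AE x in M. T (\<lambda>y. \<Sum>m. h f m y) x = (\<Sum>m. T (h f m) x)"
      by (intro operator_suminf[OF op h[OF f] hb[OF f] sbf])
    moreover have "AE x in M. \<forall>m. T (h f m) x = c * h f (Suc m) x"
      unfolding AE_all_countable
    proof
      fix m
      show "AE x in M. T (h f m) x = c * h f (Suc m) x"
        using operator_scale[OF op operator_closed[OF pop f], of "inverse (c ^ Suc m)" m]
        by eventually_elim (use c0 in \<open>simp add: h_def\<close>)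
    qed
    ultimately show ?thesis using ser(1)[OF f]
    proof eventually_elim
      case (elim x)
      have "(\<Sum>m. c * h f (Suc m) x) = c * (\<Sum>m. h f (Suc m) x)"
        using summable_Suc_iff[of "\<lambda>m. h f m x"] elim(4) by (intro suminf_mult) simp
      also have "(\<Sum>m. h f (Suc m) x) = (\<Sum>m. h f m x) - h f 0 x"
        by (rule suminf_split_head[OF elim(4)])
      finally show ?case
        using elim c0 by (simp add: R_def h_def right_diff_distrib)
    qed
  qed
  show ?thesis
    using Rop left right by (auto simp: L2_spectrum_def)
qed

lemma spectrum_le_power_bound:
  assumes op: "L2_bounded_operator M T" and m: "0 < m" and t: "0 \<le> t"
    and b: "L2_bound M (T ^^ m) (t ^ m)" and c: "c \<in> L2_spectrum M T"
  shows "cmod c \<le> t"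
proof (rule ccontr)
  assume "\<not> cmod c \<le> t"
  define s where "s = (t + cmod c) / 2"
  have s: "0 < s" "s < cmod c" "t \<le> s"
    using \<open>\<not> cmod c \<le> t\<close> t by (auto simp: s_def)
  have "L2_bound M (T ^^ m) (s ^ m)"
    using b by (rule L2_bound_mono) (intro power_mono s t)
  then obtain B where "0 < B" "\<And>n. L2_bound M (T ^^ n) (B * s ^ n)"
    using power_bound_all[OF op m s(1)] by blast
  then have "c \<notin> L2_spectrum M T" by (intro Neumann_series[OF op s(1,2)])
  then show False using c by simp
qed

text \<open>
  The half of Gelfand's formula that holds for every bounded operator.
\<close>

lemma spectral_radius_le:
  assumes op: "L2_bounded_operator M T" and m: "0 < m" and t: "0 \<le> t"
    and b: "L2_bound M (T ^^ m) (t ^ m)"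
  shows "L2_spectral_radius M T \<le> t"
  unfolding L2_spectral_radius_def
  using spectrum_le_power_bound[OF op m t b] t by (intro cSup_least) auto

lemma spectrum_le_spectral_radius:
  assumes op: "L2_bounded_operator M T"
  shows "0 \<le> L2_spectral_radius M T" and "c \<in> L2_spectrum M T \<Longrightarrow> cmod c \<le> L2_spectral_radius M T"
proof -
  obtain C where C: "0 < C" "L2_bound M T C" by (rule operator_bound[OF op])
  have "bdd_above (insert 0 (cmod ` L2_spectrum M T))"
    using spectrum_le_power_bound[OF op, of 1 C] C by (auto intro!: bdd_aboveI[of _ C])
  then show "0 \<le> L2_spectral_radius M T" "c \<in> L2_spectrum M T \<Longrightarrow> cmod c \<le> L2_spectral_radius M T"
    unfolding L2_spectral_radius_def by (auto intro!: cSup_upper)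
qed

section \<open>Gelfand's formula for positive operators\<close>

text \<open>
  The inequality \<open>\<bar>T f\<bar> \<le> T \<bar>f\<bar>\<close> between complex functions is equivalent to positivity of a
  linear \<open>T\<close>.  It is the convenient axiom because it reduces norm bounds to nonnegative functions.
  The order on complex numbers requires equal imaginary parts, so \<open>0 \<le> z\<close> says that \<open>z\<close>
  is real and nonnegative.
\<close>

definition L2_positive_operator :: "'a measure \<Rightarrow> (('a \<Rightarrow> complex) \<Rightarrow> ('a \<Rightarrow> complex)) \<Rightarrow> bool" where
  "L2_positive_operator M T \<longleftrightarrow> L2_bounded_operator M T \<and>
     (\<forall>f\<in>L2_space M. AE x in M. L2_abs (T f) x \<le> T (L2_abs f) x)"

lemma complex_le_norm: "0 \<le> (z::complex) \<Longrightarrow> z \<le> w \<Longrightarrow> cmod z \<le> cmod w"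
  by (simp add: less_eq_complex_def cmod_eq_Re)

lemma L2_abs_of_nonneg: "0 \<le> f x \<Longrightarrow> L2_abs f x = f x"
  by (simp add: L2_abs_def less_eq_complex_def complex_eq_iff cmod_eq_Re)

lemma L2_abs_nonneg [simp]: "0 \<le> L2_abs f x"
  by (simp add: L2_abs_def less_eq_complex_def)

lemma L2_norm_mono:
  assumes "f \<in> borel_measurable M" "g \<in> L2_space M" "AE x in M. 0 \<le> f x" "AE x in M. f x \<le> g x"
  shows "L2_norm M f \<le> L2_norm M g"
proof (rule L2_dominated(2)[OF assms(1,2)])
  show "AE x in M. cmod (f x) \<le> cmod (g x)"
    using assms(3,4) by eventually_elim (rule complex_le_norm)
qed

context
  fixes M :: "'a measure" and T :: "('a \<Rightarrow> complex) \<Rightarrow> ('a \<Rightarrow> complex)"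
  assumes pos: "L2_positive_operator M T"
begin

lemma positive_operatorD: "L2_bounded_operator M T"
  using pos by (simp add: L2_positive_operator_def)

lemma positive_operator_abs: "f \<in> L2_space M \<Longrightarrow> AE x in M. L2_abs (T f) x \<le> T (L2_abs f) x"
  using pos by (simp add: L2_positive_operator_def)

lemma positive_operator_nonneg:
  assumes f: "f \<in> L2_space M" "AE x in M. 0 \<le> f x"
  shows "AE x in M. 0 \<le> T f x"
proof -
  have "AE x in M. L2_abs f x = f x"
    using f(2) by eventually_elim (rule L2_abs_of_nonneg)
  then have "AE x in M. T (L2_abs f) x = T f x"
    by (intro operator_cong[OF positive_operatorD] L2_abs f)
  with positive_operator_abs[OF f(1)] show ?thesis
  proof eventually_elim
    case (elim x)
    have "0 \<le> L2_abs (T f) x" by (rule L2_abs_nonneg)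
    also have "\<dots> \<le> T f x" using elim by simp
    finally show ?case .
  qed
qed

lemma positive_operator_mono:
  assumes f: "f \<in> L2_space M" and g: "g \<in> L2_space M" and le: "AE x in M. f x \<le> g x"
  shows "AE x in M. T f x \<le> T g x"
proof -
  have "AE x in M. 0 \<le> T (\<lambda>y. g y - f y) x"
    using le by (intro positive_operator_nonneg[OF L2_diff(1)[OF g f]]) simp
  with operator_diff[OF positive_operatorD g f] show ?thesis
    by eventually_elim simp
qed

lemma positive_operator_bound:
  assumes "\<And>f. f \<in> L2_space M \<Longrightarrow> AE x in M. 0 \<le> f x \<Longrightarrow> L2_norm M (T f) \<le> C * L2_norm M f"
  shows "L2_bound M T C"
  unfolding L2_bound_def
proof
  fix f assume f: "f \<in> L2_space M"
  have cl: "T g \<in> L2_space M" if "g \<in> L2_space M" for g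
    using that by (rule operator_closed[OF positive_operatorD])
  have "L2_norm M (T f) = L2_norm M (L2_abs (T f))"
    using L2_abs(2)[OF cl[OF f]] by (rule sym)
  also have "\<dots> \<le> L2_norm M (T (L2_abs f))"
    by (rule L2_norm_mono[OF L2_measurable[OF L2_abs(1)[OF cl[OF f]]] cl[OF L2_abs(1)[OF f]]
          _ positive_operator_abs[OF f]]) simp
  also have "\<dots> \<le> C * L2_norm M (L2_abs f)"
    by (rule assms[OF L2_abs(1)[OF f]]) simp
  finally show "L2_norm M (T f) \<le> C * L2_norm M f"
    by (simp only: L2_abs(2)[OF f])
qed

end

lemma positive_operator_compose:
  assumes T: "L2_positive_operator M T" and U: "L2_positive_operator M U"
  shows "L2_positive_operator M (T \<circ> U)"
  unfolding L2_positive_operator_def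
proof (intro conjI ballI)
  note Top = positive_operatorD[OF T] and Uop = positive_operatorD[OF U]
  show "L2_bounded_operator M (T \<circ> U)"
    by (rule operator_compose[OF Top Uop])
  fix f assume f: "f \<in> L2_space M"
  have Uf: "U f \<in> L2_space M" "U (L2_abs f) \<in> L2_space M"
    by (simp_all add: operator_closed[OF Uop] L2_abs f)
  have "AE x in M. T (L2_abs (U f)) x \<le> T (U (L2_abs f)) x"
    by (intro positive_operator_mono[OF T] positive_operator_abs[OF U] L2_abs Uf f)
  with positive_operator_abs[OF T Uf(1)]
  show "AE x in M. L2_abs ((T \<circ> U) f) x \<le> (T \<circ> U) (L2_abs f) x"
    by eventually_elim (auto intro: order_trans)
qed

lemma positive_operator_funpow:
  assumes "L2_positive_operator M T"
  shows "L2_positive_operator M (T ^^ m)"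
proof (induction m)
  case 0
  show ?case
    using operator_funpow[OF positive_operatorD[OF assms], of 0] by (simp add: L2_positive_operator_def id_def)
next
  case (Suc m)
  then show ?case using positive_operator_compose[OF assms Suc] by (simp add: comp_def)
qed

text \<open>
  The partial sums of \<open>t (t - T)\<^sup>-\<^sup>1\<close>, applied to \<open>f\<close>.
\<close>

definition Neumann_sum :: "(('a \<Rightarrow> complex) \<Rightarrow> ('a \<Rightarrow> complex)) \<Rightarrow> real \<Rightarrow> nat \<Rightarrow> ('a \<Rightarrow> complex) \<Rightarrow> 'a \<Rightarrow> complex" where
  "Neumann_sum T t N f = (\<lambda>x. \<Sum>i<N. complex_of_real (1 / t ^ i) * (T ^^ i) f x)"

lemma Neumann_sum_in_L2:
  assumes "L2_bounded_operator M T" "f \<in> L2_space M"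
  shows "Neumann_sum T t N f \<in> L2_space M"
  unfolding Neumann_sum_def
  by (intro L2_sum L2_scale operator_closed[OF operator_funpow] assms)

lemma Neumann_sum_term_nonneg:
  assumes pos: "L2_positive_operator M T" and t: "0 < t"
    and f: "f \<in> L2_space M" "AE x in M. 0 \<le> f x"
  shows "AE x in M. \<forall>i. 0 \<le> complex_of_real (1 / t ^ i) * (T ^^ i) f x"
  unfolding AE_all_countable
proof
  fix i
  show "AE x in M. 0 \<le> complex_of_real (1 / t ^ i) * (T ^^ i) f x"
    using positive_operator_nonneg[OF positive_operator_funpow[OF pos] f, of i]
    by eventually_elim (use t in \<open>simp add: less_eq_complex_def\<close>)
qed

lemma Neumann_sum_nonneg:
  assumes pos: "L2_positive_operator M T" and t: "0 < t"
    and f: "f \<in> L2_space M" "AE x in M. 0 \<le> f x"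
  shows "AE x in M. 0 \<le> Neumann_sum T t N f x"
  using Neumann_sum_term_nonneg[OF pos t f]
  unfolding Neumann_sum_def by (rule eventually_mono) (blast intro: sum_nonneg)

lemma Neumann_sum_mono:
  assumes pos: "L2_positive_operator M T" and t: "0 < t"
    and f: "f \<in> L2_space M" "AE x in M. 0 \<le> f x" and le: "N \<le> n"
  shows "AE x in M. Neumann_sum T t N f x \<le> Neumann_sum T t n f x"
  using Neumann_sum_term_nonneg[OF pos t f]
  unfolding Neumann_sum_def by (rule eventually_mono) (intro sum_mono2; use le in auto)

lemma Neumann_sum_telescope:
  assumes op: "L2_bounded_operator M T" and t: "0 < t" and f: "f \<in> L2_space M"
  shows "AE x in M. T (Neumann_sum T t N f) x - complex_of_real t * Neumann_sum T t N f x
           = complex_of_real t * (complex_of_real (1 / t ^ N) * (T ^^ N) f x - f x)"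
proof -
  let ?a = "\<lambda>i x. complex_of_real (1 / t ^ i) * (T ^^ i) f x"
  have "AE x in M. T (\<lambda>x. \<Sum>i<N. ?a i x) x = (\<Sum>i<N. T (?a i) x)"
    by (intro operator_sum[OF op] L2_scale operator_closed[OF operator_funpow[OF op]] f) auto
  moreover have "AE x in M. \<forall>i. T (?a i) x = complex_of_real t * ?a (Suc i) x"
    unfolding AE_all_countable
  proof
    fix i
    show "AE x in M. T (?a i) x = complex_of_real t * ?a (Suc i) x"
      using operator_scale[OF op operator_closed[OF operator_funpow[OF op] f], of "complex_of_real (1 / t ^ i)" i]
      by eventually_elim (use t in simp)
  qed
  ultimately show ?thesis
  proof eventually_elim
    case (elim x)
    have "(\<Sum>i<N. complex_of_real t * ?a (Suc i) x) - complex_of_real t * (\<Sum>i<N. ?a i x)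
        = complex_of_real t * (\<Sum>i<N. ?a (Suc i) x - ?a i x)"
      by (simp only: sum_distrib_left sum_subtractf right_diff_distrib)
    also have "(\<Sum>i<N. ?a (Suc i) x - ?a i x) = ?a N x - ?a 0 x"
      by (rule sum_lessThan_telescope)
    finally show ?case
      using elim by (simp add: Neumann_sum_def)
  qed
qed

text \<open>
  The point of the bound is that it does not depend on \<open>N\<close> and stays finite as \<open>t\<close> decreases to
  \<open>g\<close>.  The hypothesis on \<open>C\<close> says that \<open>T - g\<close> is bounded below.  Since \<open>t\<close> is close to
  \<open>g\<close>, it transfers to \<open>T - t\<close>, which maps a partial sum with \<open>n\<close> terms to
  \<open>t (T ^^ n f / t ^ n - f)\<close>.  The term \<open>T ^^ n f / t ^ n\<close> tends to zero only at an
  uncontrolled rate, but it can be removed: partial sums of nonnegative functions increase, so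
  the \<open>N\<close>-th one is bounded by the \<open>n\<close>-th one, and \<open>n\<close> may tend to infinity.
\<close>

lemma Neumann_sum_bound:
  assumes pos: "L2_positive_operator M T"
    and C: "0 < C" "\<And>f. f \<in> L2_space M \<Longrightarrow> L2_norm M f \<le> C * L2_norm M (\<lambda>x. T f x - complex_of_real g * f x)"
    and g: "0 < g" "g < t" "C * (t - g) \<le> 1 / 2"
    and s: "0 < m" "0 < s" "s < t" "L2_bound M (T ^^ m) (s ^ m)"
    and f: "f \<in> L2_space M" "AE x in M. 0 \<le> f x"
  shows "L2_norm M (Neumann_sum T t N f) \<le> (2 * C * t) * L2_norm M f"
proof -
  note op = positive_operatorD[OF pos]
  have t: "0 < t" using g by simp
  obtain B where B: "0 < B" "\<And>n. L2_bound M (T ^^ n) (B * s ^ n)"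
    using power_bound_all[OF op s(1,2,4)] by blast
  let ?P = "\<lambda>n. Neumann_sum T t n f"
  have P: "?P n \<in> L2_space M" for n by (rule Neumann_sum_in_L2[OF op f(1)])
  have Tn: "(T ^^ n) f \<in> L2_space M" for n by (rule operator_closed[OF operator_funpow[OF op] f(1)])
  have est: "L2_norm M (?P n) \<le> 2 * C * t * (B * (s / t) ^ n * L2_norm M f + L2_norm M f)" for n
  proof -
    let ?r = "\<lambda>x. complex_of_real t * (complex_of_real (1 / t ^ n) * (T ^^ n) f x - f x)"
    let ?q = "\<lambda>x. complex_of_real (t - g) * ?P n x"
    have r: "?r \<in> L2_space M" by (intro L2_scale L2_diff Tn f)
    have q: "?q \<in> L2_space M" by (intro L2_scale P)
    have "L2_norm M (\<lambda>x. complex_of_real (1 / t ^ n) * (T ^^ n) f x) \<le> B * (s / t) ^ n * L2_norm M f"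
    proof -
      have "L2_norm M (\<lambda>x. complex_of_real (1 / t ^ n) * (T ^^ n) f x) = 1 / t ^ n * L2_norm M ((T ^^ n) f)"
        using t by (subst L2_scale(2)[OF Tn]) (simp add: norm_divide norm_power)
      also have "\<dots> \<le> 1 / t ^ n * (B * s ^ n * L2_norm M f)"
        using t by (intro mult_left_mono L2_boundD[OF B(2) f(1)]) auto
      finally show ?thesis by (simp add: power_divide)
    qed
    moreover have "L2_norm M (\<lambda>x. complex_of_real (1 / t ^ n) * (T ^^ n) f x - f x)
        \<le> L2_norm M (\<lambda>x. complex_of_real (1 / t ^ n) * (T ^^ n) f x) + L2_norm M f"
      by (intro L2_diff L2_scale Tn f)
    ultimately have "L2_norm M (\<lambda>x. complex_of_real (1 / t ^ n) * (T ^^ n) f x - f x)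
        \<le> B * (s / t) ^ n * L2_norm M f + L2_norm M f" by linarith
    then have rb: "L2_norm M ?r \<le> t * (B * (s / t) ^ n * L2_norm M f + L2_norm M f)"
      using t unfolding L2_scale(2)[OF L2_diff(1)[OF L2_scale(1)[OF Tn] f(1)]]
      by (intro mult_mono) auto
    have "AE x in M. T (?P n) x - complex_of_real g * ?P n x = ?r x + ?q x"
      using Neumann_sum_telescope[OF op t f(1), of n] by eventually_elim (simp add: algebra_simps)
    then have eq: "L2_norm M (\<lambda>x. T (?P n) x - complex_of_real g * ?P n x) = L2_norm M (\<lambda>x. ?r x + ?q x)"
      by (intro L2_norm_AE_cong L2_diff L2_add L2_scale[OF P] r q operator_closed[OF op] P)
    have "L2_norm M (?P n) \<le> C * L2_norm M (\<lambda>x. ?r x + ?q x)"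
      using C(2)[OF P, of n] by (simp only: eq)
    also have "\<dots> \<le> C * (L2_norm M ?r + L2_norm M ?q)"
      using C(1) by (intro mult_left_mono L2_add r q) auto
    also have "\<dots> = C * L2_norm M ?r + (C * (t - g)) * L2_norm M (?P n)"
      using g unfolding L2_scale(2)[OF P] norm_of_real by (simp add: distrib_left)
    also have "\<dots> \<le> C * (t * (B * (s / t) ^ n * L2_norm M f + L2_norm M f)) + 1 / 2 * L2_norm M (?P n)"
      using C(1) g rb by (intro add_mono mult_left_mono mult_right_mono) auto
    finally show ?thesis by (simp add: algebra_simps)
  qed
  have mono: "L2_norm M (?P N) \<le> L2_norm M (?P n)" if "N \<le> n" for n
    by (rule L2_norm_mono[OF L2_measurable[OF P] P Neumann_sum_nonneg[OF pos t f] Neumann_sum_mono[OF pos t f that]])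
  have "(\<lambda>n. (s / t) ^ n) \<longlonglongrightarrow> 0"
    using s t by (intro LIMSEQ_realpow_zero) (auto simp: divide_less_eq)
  then have "(\<lambda>n. 2 * C * t * (B * (s / t) ^ n * L2_norm M f + L2_norm M f))
      \<longlonglongrightarrow> 2 * C * t * (B * 0 * L2_norm M f + L2_norm M f)"
    by (intro tendsto_mult tendsto_add tendsto_const)
  then have "L2_norm M (?P N) \<le> 2 * C * t * (B * 0 * L2_norm M f + L2_norm M f)"
    by (rule Lim_bounded2[where N = N]) (meson mono est order_trans)
  then show ?thesis by simp
qed

text \<open>
  In the product of the partial sum with itself every pair of exponents \<open>i\<close> and \<open>m - i\<close>
  contributes a copy of \<open>T ^^ m f / t ^ m\<close>, and all other terms are nonnegative.
\<close>

lemma Neumann_sum_square: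
  assumes pos: "L2_positive_operator M T" and t: "0 < t"
    and f: "f \<in> L2_space M" "AE x in M. 0 \<le> f x"
  shows "AE x in M. complex_of_real (real (Suc m) / t ^ m) * (T ^^ m) f x
           \<le> Neumann_sum T t (Suc m) (Neumann_sum T t (Suc m) f) x"
proof -
  note op = positive_operatorD[OF pos]
  let ?a = "\<lambda>i x. complex_of_real (1 / t ^ i) * (T ^^ i) f x"
  let ?p = "Neumann_sum T t (Suc m) f"
  have p: "?p \<in> L2_space M" by (rule Neumann_sum_in_L2[OF op f(1)])
  have Tn: "(T ^^ n) f \<in> L2_space M" for n by (rule operator_closed[OF operator_funpow[OF op] f(1)])
  have a: "?a i \<in> L2_space M" for i by (intro L2_scale Tn)
  have le: "AE x in M. ?a (m - i) x \<le> ?p x" for i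
    using Neumann_sum_term_nonneg[OF pos t f]
  proof eventually_elim
    case (elim x)
    have "(\<Sum>j\<in>{m - i}. ?a j x) \<le> (\<Sum>j<Suc m. ?a j x)"
      using elim by (intro sum_mono2) auto
    then show ?case by (simp add: Neumann_sum_def)
  qed
  have "AE x in M. \<forall>i. i \<le> m \<longrightarrow> complex_of_real (1 / t ^ m) * (T ^^ m) f x
          \<le> complex_of_real (1 / t ^ i) * (T ^^ i) ?p x"
    unfolding AE_all_countable
  proof
    fix i
    have "AE x in M. (T ^^ i) (?a (m - i)) x \<le> (T ^^ i) ?p x"
      by (intro positive_operator_mono[OF positive_operator_funpow[OF pos]] a p le)
    with operator_scale[OF operator_funpow[OF op] Tn, of i "complex_of_real (1 / t ^ (m - i))" "m - i"]
    show "AE x in M. i \<le> m \<longrightarrow> complex_of_real (1 / t ^ m) * (T ^^ m) f x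
          \<le> complex_of_real (1 / t ^ i) * (T ^^ i) ?p x"
    proof eventually_elim
      case (elim x)
      show ?case
      proof
        assume i: "i \<le> m"
        then have "(T ^^ i) ((T ^^ (m - i)) f) = (T ^^ m) f"
          by (metis comp_apply funpow_add le_add_diff_inverse)
        moreover have "complex_of_real (1 / t ^ m)
            = complex_of_real (1 / t ^ i) * complex_of_real (1 / t ^ (m - i))"
          using i by (simp flip: of_real_mult of_real_power power_add of_real_divide)
        ultimately have "complex_of_real (1 / t ^ m) * (T ^^ m) f x
            = complex_of_real (1 / t ^ i) * (T ^^ i) (?a (m - i)) x"
          using elim(1) by simp
        also have "\<dots> \<le> complex_of_real (1 / t ^ i) * (T ^^ i) ?p x"
          using elim(2) t by (intro mult_left_mono) (auto simp: less_eq_complex_def)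
        finally show "complex_of_real (1 / t ^ m) * (T ^^ m) f x
          \<le> complex_of_real (1 / t ^ i) * (T ^^ i) ?p x" .
      qed
    qed
  qed
  then show ?thesis
  proof eventually_elim
    case (elim x)
    have "complex_of_real (real (Suc m) / t ^ m) * (T ^^ m) f x
        = (\<Sum>i<Suc m. complex_of_real (1 / t ^ m) * (T ^^ m) f x)"
      by (simp del: of_nat_Suc)
    also have "\<dots> \<le> (\<Sum>i<Suc m. complex_of_real (1 / t ^ i) * (T ^^ i) ?p x)"
      using elim by (intro sum_mono) auto
    finally show ?case by (simp only: Neumann_sum_def)
  qed
qed

text \<open>
  The converse half of Gelfand's formula.  For positive operators it amounts to the fact that
  the growth rate \<open>g\<close> of the powers is itself a spectral value if it is positive: otherwise the
  bounds on partial sums show that some power satisfies \<open>\<parallel>T ^^ m\<parallel> \<le> g ^ m / 2\<close>, and the growth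
  rate would be smaller than \<open>g\<close>.
\<close>

theorem positive_operator_power_bound:
  assumes pos: "L2_positive_operator M T" and t: "L2_spectral_radius M T < t"
  shows "\<exists>m>0. L2_bound M (T ^^ m) (t ^ m)"
proof -
  note op = positive_operatorD[OF pos]
  define A where "A = {s::real. 0 < s \<and> (\<exists>m>0. L2_bound M (T ^^ m) (s ^ m))}"
  define g where "g = Inf A"
  have r0: "0 \<le> L2_spectral_radius M T" by (rule spectrum_le_spectral_radius[OF op])
  have Abdd: "bdd_below A" by (auto simp: A_def intro!: bdd_belowI[of _ 0])
  obtain C0 where "0 < C0" "L2_bound M T C0" by (rule operator_bound[OF op])
  then have "C0 \<in> A" unfolding A_def by (auto intro: exI[of _ "1::nat"])
  then have Ane: "A \<noteq> {}" by auto
  have above: "\<exists>s'\<in>A. s' < s" if "g < s" for s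
    using that cInf_lessD[OF Ane, of s] by (auto simp: g_def)
  have "g \<le> L2_spectral_radius M T"
  proof (rule ccontr)
    assume "\<not> g \<le> L2_spectral_radius M T"
    then have gr: "L2_spectral_radius M T < g" by simp
    then have g0: "0 < g" using r0 by simp
    have "complex_of_real g \<notin> L2_spectrum M T"
      using spectrum_le_spectral_radius(2)[OF op, of "complex_of_real g"] gr g0 by auto
    then obtain R where R: "L2_bounded_operator M R"
        "\<And>f. f \<in> L2_space M \<Longrightarrow> AE x in M. R (\<lambda>y. T f y - complex_of_real g * f y) x = f x"
      by (auto simp: L2_spectrum_def)
    obtain C where C: "0 < C" "L2_bound M R C" by (rule operator_bound[OF R(1)])
    have low: "L2_norm M f \<le> C * L2_norm M (\<lambda>x. T f x - complex_of_real g * f x)" if f: "f \<in> L2_space M" for f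
    proof -
      have d: "(\<lambda>x. T f x - complex_of_real g * f x) \<in> L2_space M"
        by (intro L2_diff L2_scale operator_closed[OF op] f)
      have "L2_norm M f = L2_norm M (R (\<lambda>x. T f x - complex_of_real g * f x))"
        using L2_norm_AE_cong[OF operator_closed[OF R(1) d] f R(2)[OF f]] by simp
      then show ?thesis using L2_boundD[OF C(2) d] by simp
    qed
    \<comment> \<open>The radius around \<open>g\<close> within which the lower bound of \<open>T - g\<close> loses at most a factor 2.\<close>
    define d where "d = 1 / (2 * C)"
    define D where "D = 2 * C * (g + d)"
    have d0: "0 < d" using C by (simp add: d_def)
    have D0: "0 < D" using C g0 d0 by (simp add: D_def)
    have P: "L2_norm M (Neumann_sum T s N f) \<le> D * L2_norm M f"
      if s: "g < s" "s < g + d" and f: "f \<in> L2_space M" "AE x in M. 0 \<le> f x" for s N f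
    proof -
      obtain s' m where s': "s' < s" "0 < s'" "0 < m" "L2_bound M (T ^^ m) (s' ^ m)"
        using above[OF s(1)] by (auto simp: A_def)
      have "C * (s - g) \<le> C * d" using C s by (intro mult_left_mono) auto
      then have "L2_norm M (Neumann_sum T s N f) \<le> 2 * C * s * L2_norm M f"
        using C by (intro Neumann_sum_bound[OF pos C(1) low g0 s(1) _ s'(3,2,1,4) f]) (auto simp: d_def)
      also have "\<dots> \<le> D * L2_norm M f"
        unfolding D_def using C s by (intro mult_right_mono mult_left_mono) auto
      finally show ?thesis .
    qed
    \<comment> \<open>So large that \<open>D\<^sup>2 / (m + 1) \<le> 1 / 2\<close>, which turns the quadratic estimate into a gain.\<close>
    obtain m where m: "2 * D\<^sup>2 < real m" using reals_Archimedean2 by blast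
    then have m0: "0 < m" using D0 by (cases m) (auto simp: not_less)
    have half: "L2_norm M ((T ^^ m) f) \<le> (1 / 2 * s ^ m) * L2_norm M f"
      if s: "g < s" "s < g + d" and f: "f \<in> L2_space M" "AE x in M. 0 \<le> f x" for s f
    proof -
      have s0: "0 < s" using s g0 by simp
      let ?p = "Neumann_sum T s (Suc m) f"
      let ?l = "\<lambda>x. complex_of_real (real (Suc m) / s ^ m) * (T ^^ m) f x"
      have Tn: "(T ^^ m) f \<in> L2_space M" by (rule operator_closed[OF operator_funpow[OF op] f(1)])
      have p: "?p \<in> L2_space M" by (rule Neumann_sum_in_L2[OF op f(1)])
      have p0: "AE x in M. 0 \<le> ?p x"
        by (rule Neumann_sum_nonneg[OF pos s0 f])
      have l0: "AE x in M. 0 \<le> ?l x"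
        using positive_operator_nonneg[OF positive_operator_funpow[OF pos] f, of m]
        by eventually_elim (use s0 in \<open>auto simp: less_eq_complex_def\<close>)
      have "real (Suc m) / s ^ m * L2_norm M ((T ^^ m) f) = L2_norm M ?l"
        using s0 unfolding L2_scale(2)[OF Tn] norm_of_real by (simp del: of_nat_Suc)
      also have "\<dots> \<le> L2_norm M (Neumann_sum T s (Suc m) ?p)"
        by (intro L2_norm_mono L2_measurable L2_scale Tn Neumann_sum_in_L2[OF op] p l0 Neumann_sum_square[OF pos s0 f])
      also have "\<dots> \<le> D * L2_norm M ?p" by (rule P[OF s p p0])
      also have "\<dots> \<le> D * (D * L2_norm M f)"
        using D0 by (intro mult_left_mono P[OF s f]) auto
      also have "\<dots> = D\<^sup>2 * L2_norm M f" by (simp add: power2_eq_square)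
      also have "\<dots> \<le> real (Suc m) / 2 * L2_norm M f"
        using m by (intro mult_right_mono) auto
      finally show ?thesis using s0 by (simp add: field_simps del: of_nat_Suc)
    qed
    \<comment> \<open>The exponent \<open>m\<close> does not depend on \<open>s\<close>, so \<open>s\<close> may decrease to \<open>g\<close>.\<close>
    have "L2_norm M ((T ^^ m) f) \<le> (1 / 2 * g ^ m) * L2_norm M f"
      if f: "f \<in> L2_space M" "AE x in M. 0 \<le> f x" for f
    proof (rule tendsto_lowerbound)
      show "((\<lambda>s. (1 / 2 * s ^ m) * L2_norm M f) \<longlongrightarrow> (1 / 2 * g ^ m) * L2_norm M f) (at_right g)"
        by (intro tendsto_intros)
      show "\<forall>\<^sub>F s in at_right g. L2_norm M ((T ^^ m) f) \<le> (1 / 2 * s ^ m) * L2_norm M f"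
        unfolding eventually_at_right_field
        using half[OF _ _ f] d0 by (intro exI[of _ "g + d"]) auto
    qed simp
    then have "L2_bound M (T ^^ m) (1 / 2 * g ^ m)"
      by (intro positive_operator_bound[OF positive_operator_funpow[OF pos]])
    moreover define s where "s = root m (1 / 2) * g"
    have "s ^ m = 1 / 2 * g ^ m"
      using m0 by (simp add: s_def power_mult_distrib)
    ultimately have "L2_bound M (T ^^ m) (s ^ m)" by (simp only:)
    moreover have "0 < s" "s < g"
      using m0 g0 by (auto simp: s_def)
    ultimately have "s \<in> A" using m0 by (auto simp: A_def)
    then have "g \<le> s" unfolding g_def by (intro cInf_lower Abdd)
    then show False using \<open>s < g\<close> by simp
  qed
  then obtain s m where s: "s < t" "0 < s" "0 < m" "L2_bound M (T ^^ m) (s ^ m)"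
    using above[of t] t by (auto simp: A_def)
  then have "L2_bound M (T ^^ m) (t ^ m)"
    by (intro L2_bound_mono[OF s(4)] power_mono) auto
  then show ?thesis using s by blast
qed

section \<open>Kernels of positive operators\<close>

text \<open>
  The kernel acts here on functions with values in \<open>[0, \<infinity>]\<close>, where Tonelli's theorem holds
  without integrability conditions; \<open>kernel_of_abs\<close> is the bridge to the operator.
\<close>

definition kernel_int :: "'a measure \<Rightarrow> ('a \<times> 'a \<Rightarrow> real) \<Rightarrow> ('a \<Rightarrow> ennreal) \<Rightarrow> 'a \<Rightarrow> ennreal" where
  "kernel_int M k u x = (\<integral>\<^sup>+y. ennreal (k (x, y)) * u y \<partial>M)"

abbreviation ennabs :: "('a \<Rightarrow> complex) \<Rightarrow> 'a \<Rightarrow> ennreal" where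
  "ennabs f \<equiv> (\<lambda>x. ennreal (cmod (f x)))"

definition geometric_mean_kernel :: "('a \<times> 'a \<Rightarrow> real) \<Rightarrow> 'a \<times> 'a \<Rightarrow> real" where
  "geometric_mean_kernel k = (\<lambda>(x, y). sqrt (k (x, y) * k (y, x)))"

lemma kernel_int_cong_AE:
  "AE y in M. u y = v y \<Longrightarrow> kernel_int M k u x = kernel_int M k v x"
  unfolding kernel_int_def by (intro nn_integral_cong_AE) (auto elim!: eventually_mono)

lemma kernel_of_abs:
  assumes k: "is_kernel_of M k T" and f: "f \<in> L2_space M"
  shows "AE x in M. kernel_int M k (ennabs f) x = ennabs (T (L2_abs f)) x"
    and "AE x in M. 0 \<le> T (L2_abs f) x"
    and "AE x in M. L2_abs (T f) x \<le> T (L2_abs f) x"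
proof -
  have kpos: "\<And>x y. x \<in> space M \<Longrightarrow> y \<in> space M \<Longrightarrow> 0 \<le> k (x, y)"
    using k by (auto simp: is_kernel_of_def)
  have "AE x in M. x \<in> space M \<and>
      integrable M (\<lambda>y. complex_of_real (k (x, y)) * f y) \<and>
      T f x = (\<integral>y. complex_of_real (k (x, y)) * f y \<partial>M) \<and>
      integrable M (\<lambda>y. complex_of_real (k (x, y)) * L2_abs f y) \<and>
      T (L2_abs f) x = (\<integral>y. complex_of_real (k (x, y)) * L2_abs f y \<partial>M)"
    using k f L2_abs(1)[OF f] by (auto simp: is_kernel_of_def)
  then have "AE x in M. kernel_int M k (ennabs f) x = ennabs (T (L2_abs f)) x \<and>
      0 \<le> T (L2_abs f) x \<and> L2_abs (T f) x \<le> T (L2_abs f) x"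
  proof eventually_elim
    case (elim x)
    let ?g = "\<lambda>y. k (x, y) * cmod (f y)"
    have x: "x \<in> space M" using elim by simp
    have eq: "complex_of_real (k (x, y)) * L2_abs f y = complex_of_real (?g y)" for y
      by (simp add: L2_abs_def)
    have g: "integrable M ?g"
      using elim unfolding eq by (auto simp only: complex_of_real_integrable_eq)
    have T: "T (L2_abs f) x = complex_of_real (\<integral>y. ?g y \<partial>M)"
      using elim unfolding eq by (auto simp only: integral_complex_of_real)
    have g0: "AE y in M. 0 \<le> ?g y"
      using kpos[OF x] by (intro AE_I2) auto
    have I0: "0 \<le> (\<integral>y. ?g y \<partial>M)"
      by (intro integral_nonneg_AE g0)
    have "kernel_int M k (ennabs f) x = (\<integral>\<^sup>+y. ennreal (?g y) \<partial>M)"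
      unfolding kernel_int_def using kpos[OF x] by (intro nn_integral_cong) (simp add: ennreal_mult)
    also have "\<dots> = ennreal (\<integral>y. ?g y \<partial>M)"
      by (rule nn_integral_eq_integral[OF g g0])
    finally have 1: "kernel_int M k (ennabs f) x = ennabs (T (L2_abs f)) x"
      using I0 by (simp add: T)
    have "cmod (T f x) \<le> (\<integral>y. cmod (complex_of_real (k (x, y)) * f y) \<partial>M)"
      using elim by (auto intro: integral_norm_bound)
    also have "\<dots> = (\<integral>y. ?g y \<partial>M)"
      using kpos[OF x] by (intro Bochner_Integration.integral_cong) (auto simp: norm_mult)
    finally have "L2_abs (T f) x \<le> T (L2_abs f) x"
      unfolding T by (simp add: L2_abs_def[of "T f"] less_eq_complex_def)
    then show ?case
      using 1 I0 by (simp add: T less_eq_complex_def)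
  qed
  then show "AE x in M. kernel_int M k (ennabs f) x = ennabs (T (L2_abs f)) x"
      "AE x in M. 0 \<le> T (L2_abs f) x" "AE x in M. L2_abs (T f) x \<le> T (L2_abs f) x"
    by (auto elim!: eventually_mono)
qed

lemma kernel_operator_positive:
  assumes "L2_bounded_operator M T" "is_kernel_of M k T"
  shows "L2_positive_operator M T"
  using kernel_of_abs(3)[OF assms(2)] assms(1) by (simp add: L2_positive_operator_def)

lemma kernel_measurable:
  assumes "is_kernel_of M k T"
  shows "k \<in> borel_measurable (M \<Otimes>\<^sub>M M)"
  using assms by (simp add: is_kernel_of_def)

lemma kernel_nonneg:
  assumes "is_kernel_of M k T" "x \<in> space M" "y \<in> space M"
  shows "0 \<le> k (x, y)"
  using assms by (simp add: is_kernel_of_def)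

lemma kernel_int_kernel_int:
  assumes k: "is_kernel_of M k T" and op: "L2_bounded_operator M T" and f: "f \<in> L2_space M"
  shows "AE x in M. kernel_int M k (kernel_int M k (ennabs f)) x = ennabs (T (T (L2_abs f))) x"
proof -
  let ?g = "T (L2_abs f)"
  have g: "?g \<in> L2_space M" by (intro operator_closed[OF op] L2_abs f)
  have "AE x in M. L2_abs ?g x = ?g x"
    using kernel_of_abs(2)[OF k f] by eventually_elim (rule L2_abs_of_nonneg)
  then have "AE x in M. T (L2_abs ?g) x = T ?g x"
    by (intro operator_cong[OF op] L2_abs g)
  moreover have "kernel_int M k (kernel_int M k (ennabs f)) x = kernel_int M k (ennabs ?g) x" for x
    by (rule kernel_int_cong_AE[OF kernel_of_abs(1)[OF k f]])
  ultimately show ?thesis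
    using kernel_of_abs(1)[OF k g] by auto
qed

context sigma_finite_measure
begin

interpretation pair: pair_sigma_finite M M ..

lemma kernel_int_measurable [measurable]:
  assumes [measurable]: "k \<in> borel_measurable (M \<Otimes>\<^sub>M M)" "u \<in> borel_measurable M"
  shows "kernel_int M k u \<in> borel_measurable M"
  unfolding kernel_int_def[abs_def] by measurable

lemma geometric_mean_kernel_measurable [measurable]:
  assumes [measurable]: "k \<in> borel_measurable (M \<Otimes>\<^sub>M M)"
  shows "geometric_mean_kernel k \<in> borel_measurable (M \<Otimes>\<^sub>M M)"
  unfolding geometric_mean_kernel_def by measurable

text \<open>
  Fubini's theorem applies to \<open>k(x,z) l(z,y) f(y)\<close> because the integral of its absolute value is
  the value at \<open>x\<close> of \<open>T (U \<bar>f\<bar>)\<close>, which is finite for almost every \<open>x\<close>.  At points where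
  \<open>z \<mapsto> k(x,z) l(z,y)\<close> is not integrable the stated kernel takes the value \<open>0\<close>.
\<close>

lemma kernel_compose:
  assumes T: "L2_bounded_operator M T" "is_kernel_of M k T"
    and U: "L2_bounded_operator M U" "is_kernel_of M l U"
  shows "is_kernel_of M (\<lambda>(x, y). \<integral>z. k (x, z) * l (z, y) \<partial>M) (T \<circ> U)"
  unfolding is_kernel_of_def
proof (intro conjI ballI)
  note [measurable] = kernel_measurable[OF T(2)] kernel_measurable[OF U(2)]
  show "(\<lambda>(x, y). \<integral>z. k (x, z) * l (z, y) \<partial>M) \<in> borel_measurable (M \<Otimes>\<^sub>M M)"
    by measurable
  show "0 \<le> (case (x, y) of (x, y) \<Rightarrow> \<integral>z. k (x, z) * l (z, y) \<partial>M)"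
    if "x \<in> space M" "y \<in> space M" for x y
    using that kernel_nonneg[OF T(2)] kernel_nonneg[OF U(2)]
    by (auto intro!: integral_nonneg_AE AE_I2)
  fix f assume f: "f \<in> L2_space M"
  note [measurable] = L2_measurable[OF f]
  let ?g = "U (L2_abs f)"
  have g: "?g \<in> L2_space M" and Uf: "U f \<in> L2_space M"
    by (intro operator_closed[OF U(1)] L2_abs f)+
  note [measurable] = L2_measurable[OF Uf]
  have Ufk: "AE z in M. U f z = (\<integral>y. complex_of_real (l (z, y)) * f y \<partial>M)"
    using U(2) f by (auto simp: is_kernel_of_def)
  have TUf: "AE x in M. T (U f) x = (\<integral>z. complex_of_real (k (x, z)) * U f z \<partial>M)"
    using T(2) Uf by (auto simp: is_kernel_of_def)
  show "AE x in M. integrable M (\<lambda>y. complex_of_real (case (x, y) of (x, y) \<Rightarrow> \<integral>z. k (x, z) * l (z, y) \<partial>M) * f y) \<and>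
      (T \<circ> U) f x = (\<integral>y. complex_of_real (case (x, y) of (x, y) \<Rightarrow> \<integral>z. k (x, z) * l (z, y) \<partial>M) * f y \<partial>M)"
    using TUf kernel_of_abs(1)[OF T(2) g] AE_space
  proof eventually_elim
    case (elim x)
    note [measurable] = elim(3)
    let ?F = "\<lambda>z y. complex_of_real (k (x, z)) * complex_of_real (l (z, y)) * f y"
    have Fm: "case_prod ?F \<in> borel_measurable (M \<Otimes>\<^sub>M M)" by measurable
    have "(\<integral>\<^sup>+p. ennreal (norm (case_prod ?F p)) \<partial>(M \<Otimes>\<^sub>M M))
        = (\<integral>\<^sup>+z. \<integral>\<^sup>+y. ennreal (norm (?F z y)) \<partial>M \<partial>M)"
      using Fm by (subst nn_integral_fst[symmetric]) auto
    also have "\<dots> = (\<integral>\<^sup>+z. ennreal (k (x, z)) * kernel_int M l (ennabs f) z \<partial>M)"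
    proof (intro nn_integral_cong)
      fix z assume z: "z \<in> space M"
      have "(\<integral>\<^sup>+y. ennreal (norm (?F z y)) \<partial>M) = (\<integral>\<^sup>+y. ennreal (k (x, z)) * (ennreal (l (z, y)) * ennabs f y) \<partial>M)"
        using elim(3) z kernel_nonneg[OF T(2)] kernel_nonneg[OF U(2)]
        by (intro nn_integral_cong) (simp add: norm_mult ennreal_mult mult.assoc)
      also have "\<dots> = ennreal (k (x, z)) * kernel_int M l (ennabs f) z"
        unfolding kernel_int_def using z by (intro nn_integral_cmult) measurable
      finally show "(\<integral>\<^sup>+y. ennreal (norm (?F z y)) \<partial>M) = ennreal (k (x, z)) * kernel_int M l (ennabs f) z" .
    qed
    also have "\<dots> = kernel_int M k (ennabs ?g) x"
      unfolding kernel_int_def[of M k]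
      using kernel_of_abs(1)[OF U(2) f] by (intro nn_integral_cong_AE) (auto elim!: eventually_mono)
    also have "\<dots> < \<infinity>" using elim by simp
    finally have F: "integrable (M \<Otimes>\<^sub>M M) (case_prod ?F)"
      using Fm by (intro integrableI_bounded)
    have inner: "(\<integral>z. ?F z y \<partial>M) = complex_of_real (\<integral>z. k (x, z) * l (z, y) \<partial>M) * f y" for y
      by (simp flip: of_real_mult)
    have "integrable M (\<lambda>y. \<integral>z. ?F z y \<partial>M)"
      by (rule pair.integrable_snd[OF F])
    moreover have "T (U f) x = (\<integral>z. (\<integral>y. ?F z y \<partial>M) \<partial>M)"
    proof -
      have "(\<integral>z. complex_of_real (k (x, z)) * U f z \<partial>M)
          = (\<integral>z. complex_of_real (k (x, z)) * (\<integral>y. complex_of_real (l (z, y)) * f y \<partial>M) \<partial>M)"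
        using Ufk by (intro integral_cong_AE) (auto elim!: eventually_mono)
      also have "\<dots> = (\<integral>z. (\<integral>y. ?F z y \<partial>M) \<partial>M)"
        by (simp add: mult.assoc)
      finally show ?thesis using elim(1) by simp
    qed
    moreover have "(\<integral>z. (\<integral>y. ?F z y \<partial>M) \<partial>M) = (\<integral>y. (\<integral>z. ?F z y \<partial>M) \<partial>M)"
      by (rule pair.Fubini_integral[OF F, symmetric])
    ultimately show ?case
      unfolding inner by simp
  qed
qed

lemma positive_L2_weight:
  obtains w :: "'a \<Rightarrow> real" where "w \<in> borel_measurable M" "\<And>x. x \<in> space M \<Longrightarrow> 0 < w x"
    "(\<lambda>x. complex_of_real (w x)) \<in> L2_space M"
proof -
  obtain h where h: "h \<in> borel_measurable M" "integral\<^sup>N M h \<noteq> \<infinity>" "\<forall>x\<in>space M. 0 < h x \<and> h x < \<infinity>"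
    using Ex_finite_integrable_function by blast
  note [measurable] = h(1)
  let ?w = "\<lambda>x. sqrt (enn2real (h x))"
  have "(\<integral>\<^sup>+x. (ennreal (cmod (complex_of_real (?w x))))\<^sup>2 \<partial>M) = integral\<^sup>N M h"
    using h(3) by (intro nn_integral_cong) (auto simp: ennreal_power)
  then have "(\<integral>\<^sup>+x. (ennreal (cmod (complex_of_real (?w x))))\<^sup>2 \<partial>M)
      \<le> ennreal ((sqrt (enn2real (integral\<^sup>N M h)))\<^sup>2)"
    using h(2) by (simp add: top.not_eq_extremum)
  then have "(\<lambda>x. complex_of_real (?w x)) \<in> L2_space M"
    by (intro L2_spaceI(1)[where A = "sqrt (enn2real (integral\<^sup>N M h))"]) measurable
  moreover have "0 < ?w x" if "x \<in> space M" for x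
    using h(3) that by (auto simp: enn2real_positive_iff)
  ultimately show ?thesis
    using that[of ?w] by simp
qed

text \<open>
  Two kernels with the same action have the same integral over every rectangle, after
  multiplication by \<open>w(x) w(y)\<close> with \<open>w\<close> strictly positive and square-integrable.  The weight
  makes the total mass finite, so that rectangles determine the measure, and it is then divided out.
  One of the kernels may take the value \<open>\<infinity>\<close>: the conclusion includes that it is finite almost
  everywhere, which is how finiteness of composed kernels is obtained.
\<close>

lemma kernel_unique:
  fixes \<kappa> :: "'a \<times> 'a \<Rightarrow> ennreal"
  assumes op: "L2_bounded_operator M T" and k: "is_kernel_of M k T"
    and \<kappa>: "\<kappa> \<in> borel_measurable (M \<Otimes>\<^sub>M M)"
    and eq: "\<And>f. f \<in> L2_space M \<Longrightarrow>
      AE x in M. (\<integral>\<^sup>+y. \<kappa> (x, y) * ennabs f y \<partial>M) = kernel_int M k (ennabs f) x"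
  shows "AE p in M \<Otimes>\<^sub>M M. \<kappa> p = ennreal (k p)"
proof -
  obtain w :: "'a \<Rightarrow> real" where w: "w \<in> borel_measurable M" "\<And>x. x \<in> space M \<Longrightarrow> 0 < w x"
    "(\<lambda>x. complex_of_real (w x)) \<in> L2_space M"
    using positive_L2_weight by metis
  note [measurable] = w(1) \<kappa> kernel_measurable[OF k]
  let ?W = "\<lambda>p. ennreal (w (fst p)) * ennreal (w (snd p))"
  let ?F = "\<lambda>p. \<kappa> p * ?W p" and ?G = "\<lambda>p. ennreal (k p) * ?W p"
  have rect: "emeasure (density (M \<Otimes>\<^sub>M M) (\<lambda>p. q p * ?W p)) (A \<times> B)
      = (\<integral>\<^sup>+x. ennreal (w x) * indicator A x * (\<integral>\<^sup>+y. q (x, y) * ennabs (\<lambda>y. complex_of_real (w y) * indicator B y) y \<partial>M) \<partial>M)"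
    if q [measurable]: "q \<in> borel_measurable (M \<Otimes>\<^sub>M M)" and [measurable]: "A \<in> sets M" "B \<in> sets M"
    for q :: "'a \<times> 'a \<Rightarrow> ennreal" and A B
  proof -
    have "emeasure (density (M \<Otimes>\<^sub>M M) (\<lambda>p. q p * ?W p)) (A \<times> B)
        = (\<integral>\<^sup>+p. q p * ?W p * indicator (A \<times> B) p \<partial>(M \<Otimes>\<^sub>M M))"
      by (rule emeasure_density) measurable
    also have "\<dots> = (\<integral>\<^sup>+x. \<integral>\<^sup>+y. q (x, y) * ?W (x, y) * indicator (A \<times> B) (x, y) \<partial>M \<partial>M)"
      by (rule nn_integral_fst[symmetric]) measurable
    also have "\<dots> = (\<integral>\<^sup>+x. ennreal (w x) * indicator A x * (\<integral>\<^sup>+y. q (x, y) * ennabs (\<lambda>y. complex_of_real (w y) * indicator B y) y \<partial>M) \<partial>M)"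
    proof (intro nn_integral_cong)
      fix x assume [measurable]: "x \<in> space M"
      have "(\<integral>\<^sup>+y. q (x, y) * ?W (x, y) * indicator (A \<times> B) (x, y) \<partial>M)
          = (\<integral>\<^sup>+y. ennreal (w x) * indicator A x * (q (x, y) * ennabs (\<lambda>y. complex_of_real (w y) * indicator B y) y) \<partial>M)"
      proof (intro nn_integral_cong)
        fix y assume "y \<in> space M"
        then have "0 \<le> w y" using w(2)[of y] by simp
        then show "q (x, y) * ?W (x, y) * indicator (A \<times> B) (x, y)
            = ennreal (w x) * indicator A x * (q (x, y) * ennabs (\<lambda>y. complex_of_real (w y) * indicator B y) y)"
          by (auto simp: indicator_def norm_mult mult_ac)
      qed
      also have "\<dots> = ennreal (w x) * indicator A x * (\<integral>\<^sup>+y. q (x, y) * ennabs (\<lambda>y. complex_of_real (w y) * indicator B y) y \<partial>M)"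
        by (rule nn_integral_cmult) measurable
      finally show "(\<integral>\<^sup>+y. q (x, y) * ?W (x, y) * indicator (A \<times> B) (x, y) \<partial>M)
          = ennreal (w x) * indicator A x * (\<integral>\<^sup>+y. q (x, y) * ennabs (\<lambda>y. complex_of_real (w y) * indicator B y) y \<partial>M)" .
    qed
    finally show ?thesis .
  qed
  have fB: "(\<lambda>y. complex_of_real (w y) * indicator B y) \<in> L2_space M" if "B \<in> sets M" for B
    using that by (intro L2_dominated(1)[OF _ w(3)]) (auto simp: norm_mult indicator_def)
  have same: "emeasure (density (M \<Otimes>\<^sub>M M) ?F) (A \<times> B) = emeasure (density (M \<Otimes>\<^sub>M M) ?G) (A \<times> B)"
    if A: "A \<in> sets M" and B: "B \<in> sets M" for A B
  proof -
    have "emeasure (density (M \<Otimes>\<^sub>M M) ?F) (A \<times> B)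
      = (\<integral>\<^sup>+x. ennreal (w x) * indicator A x * (\<integral>\<^sup>+y. \<kappa> (x, y) * ennabs (\<lambda>y. complex_of_real (w y) * indicator B y) y \<partial>M) \<partial>M)"
      by (rule rect[OF \<kappa> A B])
    also have "\<dots> = (\<integral>\<^sup>+x. ennreal (w x) * indicator A x * (\<integral>\<^sup>+y. ennreal (k (x, y)) * ennabs (\<lambda>y. complex_of_real (w y) * indicator B y) y \<partial>M) \<partial>M)"
      using eq[OF fB[OF B]] unfolding kernel_int_def
      by (intro nn_integral_cong_AE) (erule eventually_mono, simp only:)
    also have "\<dots> = emeasure (density (M \<Otimes>\<^sub>M M) ?G) (A \<times> B)"
      by (rule rect[symmetric, OF _ A B]) measurable
    finally show ?thesis .
  qed
  have fin: "integral\<^sup>N (M \<Otimes>\<^sub>M M) ?G \<noteq> \<infinity>"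
  proof -
    let ?g = "\<lambda>y. complex_of_real (w y) * indicator (space M) y"
    have Tg: "T (L2_abs ?g) \<in> L2_space M" by (intro operator_closed[OF op] L2_abs fB) auto
    have "integral\<^sup>N (M \<Otimes>\<^sub>M M) ?G = emeasure (density (M \<Otimes>\<^sub>M M) ?G) (space M \<times> space M)"
      by (subst emeasure_density) (auto simp: space_pair_measure intro!: nn_integral_cong)
    also have "\<dots> = (\<integral>\<^sup>+x. ennreal (w x) * indicator (space M) x * kernel_int M k (ennabs ?g) x \<partial>M)"
      unfolding kernel_int_def by (intro rect) auto
    also have "\<dots> = (\<integral>\<^sup>+x. ennabs ?g x * ennabs (T (L2_abs ?g)) x \<partial>M)"
    proof (intro nn_integral_cong_AE)
      show "AE x in M. ennreal (w x) * indicator (space M) x * kernel_int M k (ennabs ?g) x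
          = ennabs ?g x * ennabs (T (L2_abs ?g)) x"
        using kernel_of_abs(1)[OF k fB[OF sets.top]] AE_space
      proof eventually_elim
        case (elim x)
        then have "0 < w x" using w(2) by simp
        then show ?case using elim by (simp add: norm_mult)
      qed
    qed
    also have "\<dots> < \<infinity>"
      using L2_Cauchy_Schwarz[OF fB[OF sets.top] Tg] by (auto intro: le_less_trans)
    finally show ?thesis by simp
  qed
  have "density (M \<Otimes>\<^sub>M M) ?F = density (M \<Otimes>\<^sub>M M) ?G"
  proof (rule measure_eqI_generator_eq[OF Int_stable_pair_measure_generator[of M M]])
    show "{a \<times> b |a b. a \<in> sets M \<and> b \<in> sets M} \<subseteq> Pow (space M \<times> space M)"
      by (auto dest: sets.sets_into_space)
    show "sets (density (M \<Otimes>\<^sub>M M) ?F) = sigma_sets (space M \<times> space M) {a \<times> b |a b. a \<in> sets M \<and> b \<in> sets M}"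
      "sets (density (M \<Otimes>\<^sub>M M) ?G) = sigma_sets (space M \<times> space M) {a \<times> b |a b. a \<in> sets M \<and> b \<in> sets M}"
      by (simp_all add: sets_pair_measure)
    show "range (\<lambda>i::nat. space M \<times> space M) \<subseteq> {a \<times> b |a b. a \<in> sets M \<and> b \<in> sets M}"
      by auto
    show "(\<Union>i::nat. space M \<times> space M) = space M \<times> space M" by auto
    show "emeasure (density (M \<Otimes>\<^sub>M M) ?F) (space M \<times> space M) \<noteq> \<infinity>" for i :: nat
    proof -
      have "emeasure (density (M \<Otimes>\<^sub>M M) ?G) (space M \<times> space M) = integral\<^sup>N (M \<Otimes>\<^sub>M M) ?G"
        by (subst emeasure_density) (auto simp: space_pair_measure intro!: nn_integral_cong)
      then show ?thesis using same[of "space M" "space M"] fin by simp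
    qed
  qed (use same in auto)
  then have "AE p in M \<Otimes>\<^sub>M M. ?G p = ?F p"
    using fin by (subst finite_density_unique[symmetric]) auto
  then show ?thesis
    using AE_space
  proof eventually_elim
    case (elim p)
    then have "0 < w (fst p)" "0 < w (snd p)"
      using w(2) by (auto simp: space_pair_measure)
    then have "?W p \<noteq> 0" "?W p \<noteq> top" by (auto simp: ennreal_mult_eq_top_iff)
    then show ?case
      using elim(1) mult_divide_eq_ennreal[of "?W p" "\<kappa> p"] mult_divide_eq_ennreal[of "?W p" "ennreal (k p)"]
      by simp
  qed
qed

section \<open>Geometric symmetrization\<close>

text \<open>
  Write \<open>E\<close> for the action of \<open>k\<close> on \<open>u = \<bar>f\<bar>\<close> and \<open>E'\<close> for that of the transposed
  kernel.  Cauchy-Schwarz gives the pointwise bound \<open>E E'\<close> for the integrand, and by Tonelli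
  \<open>\<integral> E E' = \<integral> u (T\<^sup>2 u) \<le> D \<parallel>f\<parallel>\<^sup>2\<close>.  So this one estimate shows that the symmetrization is
  bounded and controls its norm.
\<close>

lemma geometric_mean_kernel_int_bound:
  assumes op: "L2_bounded_operator M T" and k: "is_kernel_of M k T"
    and D: "L2_bound M (T \<circ> T) D" and f: "f \<in> L2_space M"
  shows "(\<integral>\<^sup>+x. (kernel_int M (geometric_mean_kernel k) (ennabs f) x)\<^sup>2 \<partial>M) \<le> ennreal (D * (L2_norm M f)\<^sup>2)"
proof -
  note [measurable] = kernel_measurable[OF k] L2_measurable[OF f]
  let ?u = "ennabs f"
  let ?E = "kernel_int M k ?u" and ?E' = "kernel_int M (\<lambda>(x, y). k (y, x)) ?u"
  let ?h = "T (T (L2_abs f))"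
  have h: "?h \<in> L2_space M" by (intro operator_closed[OF op] L2_abs f)
  have "(kernel_int M (geometric_mean_kernel k) ?u x)\<^sup>2 \<le> ?E x * ?E' x" if [measurable]: "x \<in> space M" for x
  proof -
    let ?a = "\<lambda>y. ennreal (sqrt (k (x, y) * cmod (f y)))" and ?b = "\<lambda>y. ennreal (sqrt (k (y, x) * cmod (f y)))"
    have "kernel_int M (geometric_mean_kernel k) ?u x = (\<integral>\<^sup>+y. ?a y * ?b y \<partial>M)"
      unfolding kernel_int_def geometric_mean_kernel_def
    proof (intro nn_integral_cong)
      fix y assume "y \<in> space M"
      then have "0 \<le> k (x, y)" "0 \<le> k (y, x)" using kernel_nonneg[OF k] that by auto
      then show "ennreal (case (x, y) of (x, y) \<Rightarrow> sqrt (k (x, y) * k (y, x))) * ?u y = ?a y * ?b y"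
        by (simp add: real_sqrt_mult flip: ennreal_mult)
    qed
    also have "\<dots>\<^sup>2 \<le> (\<integral>\<^sup>+y. (?a y)\<^sup>2 \<partial>M) * (\<integral>\<^sup>+y. (?b y)\<^sup>2 \<partial>M)"
      by (intro Cauchy_Schwarz_nn_integral) measurable
    also have "(\<integral>\<^sup>+y. (?a y)\<^sup>2 \<partial>M) = ?E x"
      unfolding kernel_int_def using kernel_nonneg[OF k] that
      by (intro nn_integral_cong) (simp add: ennreal_power ennreal_mult)
    also have "(\<integral>\<^sup>+y. (?b y)\<^sup>2 \<partial>M) = ?E' x"
      unfolding kernel_int_def using kernel_nonneg[OF k] that
      by (intro nn_integral_cong) (simp add: ennreal_power ennreal_mult)
    finally show ?thesis .
  qed
  then have "(\<integral>\<^sup>+x. (kernel_int M (geometric_mean_kernel k) ?u x)\<^sup>2 \<partial>M) \<le> (\<integral>\<^sup>+x. ?E x * ?E' x \<partial>M)"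
    by (intro nn_integral_mono)
  also have "\<dots> = (\<integral>\<^sup>+x. \<integral>\<^sup>+y. ?E x * (ennreal (k (y, x)) * ?u y) \<partial>M \<partial>M)"
  proof (intro nn_integral_cong)
    fix x assume [measurable]: "x \<in> space M"
    show "?E x * ?E' x = (\<integral>\<^sup>+y. ?E x * (ennreal (k (y, x)) * ?u y) \<partial>M)"
      unfolding kernel_int_def[of M "\<lambda>(x, y). k (y, x)"] prod.case by (rule nn_integral_cmult[symmetric]) measurable
  qed
  also have "\<dots> = (\<integral>\<^sup>+y. \<integral>\<^sup>+x. ?E x * (ennreal (k (y, x)) * ?u y) \<partial>M \<partial>M)"
    by (rule pair.Fubini') measurable
  also have "\<dots> = (\<integral>\<^sup>+y. ?u y * kernel_int M k ?E y \<partial>M)"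
  proof (intro nn_integral_cong)
    fix y assume [measurable]: "y \<in> space M"
    have "(\<integral>\<^sup>+x. ?E x * (ennreal (k (y, x)) * ?u y) \<partial>M) = (\<integral>\<^sup>+x. ?u y * (ennreal (k (y, x)) * ?E x) \<partial>M)"
      by (simp add: mult_ac)
    also have "\<dots> = ?u y * kernel_int M k ?E y"
      unfolding kernel_int_def[of M k ?E] by (rule nn_integral_cmult) measurable
    finally show "(\<integral>\<^sup>+x. ?E x * (ennreal (k (y, x)) * ?u y) \<partial>M) = ?u y * kernel_int M k ?E y" .
  qed
  also have "\<dots> = (\<integral>\<^sup>+y. ?u y * ennabs ?h y \<partial>M)"
    using kernel_int_kernel_int[OF k op f] by (intro nn_integral_cong_AE) (auto elim!: eventually_mono)
  also have "\<dots> \<le> ennreal (L2_norm M f * L2_norm M ?h)"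
    by (rule L2_Cauchy_Schwarz[OF f h])
  also have "\<dots> \<le> ennreal (D * (L2_norm M f)\<^sup>2)"
  proof (intro ennreal_leI)
    have "L2_norm M ?h \<le> D * L2_norm M f"
      using L2_boundD[OF D L2_abs(1)[OF f]] L2_abs(2)[OF f] by simp
    then have "L2_norm M f * L2_norm M ?h \<le> L2_norm M f * (D * L2_norm M f)"
      by (intro mult_left_mono) auto
    then show "L2_norm M f * L2_norm M ?h \<le> D * (L2_norm M f)\<^sup>2"
      by (simp add: power2_eq_square mult_ac)
  qed
  finally show ?thesis .
qed

lemma kernel_operator_bounded:
  assumes s: "s \<in> borel_measurable (M \<Otimes>\<^sub>M M)" "\<And>x y. x \<in> space M \<Longrightarrow> y \<in> space M \<Longrightarrow> 0 \<le> s (x, y)"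
    and C: "0 \<le> C"
    and bound: "\<And>f. f \<in> L2_space M \<Longrightarrow>
      (\<integral>\<^sup>+x. (kernel_int M s (ennabs f) x)\<^sup>2 \<partial>M) \<le> ennreal ((C * L2_norm M f)\<^sup>2)"
  shows "L2_bounded_operator M (kernel_operator M s)"
    and "is_kernel_of M s (kernel_operator M s)"
    and "L2_bound M (kernel_operator M s) C"
proof -
  note [measurable] = s(1)
  let ?S = "kernel_operator M s"
  have int: "AE x in M. integrable M (\<lambda>y. complex_of_real (s (x, y)) * f y) \<and> cmod (?S f x) \<le> kernel_int M s (ennabs f) x"
    if f: "f \<in> L2_space M" for f
  proof -
    note [measurable] = L2_measurable[OF f]
    have "AE x in M. (kernel_int M s (ennabs f) x)\<^sup>2 \<noteq> \<infinity>"
      using bound[OF f] by (intro nn_integral_PInf_AE) (auto simp: top_unique)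
    then show ?thesis
      using AE_space
    proof eventually_elim
      case (elim x)
      note [measurable] = elim(2)
      let ?g = "\<lambda>y. complex_of_real (s (x, y)) * f y"
      have "(\<integral>\<^sup>+y. ennreal (norm (?g y)) \<partial>M) = kernel_int M s (ennabs f) x"
        unfolding kernel_int_def using elim(2) s(2)
        by (intro nn_integral_cong) (simp add: norm_mult ennreal_mult)
      moreover have "kernel_int M s (ennabs f) x < \<infinity>"
        using elim(1) by (cases "kernel_int M s (ennabs f) x = top") (auto simp: power2_eq_square less_top)
      moreover have "?g \<in> borel_measurable M" by measurable
      ultimately have g: "integrable M ?g" by (intro integrableI_bounded) auto
      then have "ennreal (cmod (?S f x)) \<le> (\<integral>\<^sup>+y. ennreal (norm (?g y)) \<partial>M)"
        unfolding kernel_operator_def by (rule integral_norm_bound_ennreal)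
      with g show ?case
        using \<open>(\<integral>\<^sup>+y. ennreal (norm (?g y)) \<partial>M) = kernel_int M s (ennabs f) x\<close> by simp
    qed
  qed
  have S: "?S f \<in> L2_space M" "L2_norm M (?S f) \<le> C * L2_norm M f" if f: "f \<in> L2_space M" for f
  proof -
    note [measurable] = L2_measurable[OF f]
    have m: "?S f \<in> borel_measurable M" unfolding kernel_operator_def by measurable
    have "(\<integral>\<^sup>+x. (ennabs (?S f) x)\<^sup>2 \<partial>M) \<le> (\<integral>\<^sup>+x. (kernel_int M s (ennabs f) x)\<^sup>2 \<partial>M)"
      by (intro nn_integral_mono_AE eventually_mono[OF int[OF f]]) (auto intro!: power_mono)
    also have "\<dots> \<le> ennreal ((C * L2_norm M f)\<^sup>2)" by (rule bound[OF f])
    finally show "?S f \<in> L2_space M" "L2_norm M (?S f) \<le> C * L2_norm M f"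
      using L2_spaceI[OF m, of "C * L2_norm M f"] C by simp_all
  qed
  show "L2_bound M ?S C" using S by (simp add: L2_bound_def)
  show "is_kernel_of M s ?S"
    using int s by (auto simp: is_kernel_of_def kernel_operator_def elim!: eventually_mono)
  show "L2_bounded_operator M ?S"
    unfolding L2_bounded_operator_def
  proof (intro conjI ballI allI impI)
    show "AE x in M. ?S f x = ?S g x"
      if f: "f \<in> L2_space M" and g: "g \<in> L2_space M" and fg: "AE x in M. f x = g x" for f g
      using AE_space
    proof eventually_elim
      case (elim x)
      note [measurable] = elim L2_measurable[OF f] L2_measurable[OF g]
      show ?case unfolding kernel_operator_def
        using fg by (intro integral_cong_AE) (auto elim!: eventually_mono)
    qed
    show "AE x in M. ?S (\<lambda>y. f y + g y) x = ?S f x + ?S g x"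
      if "f \<in> L2_space M" "g \<in> L2_space M" for f g
      using int[OF that(1)] int[OF that(2)]
      by eventually_elim (simp add: kernel_operator_def distrib_left)
    show "AE x in M. ?S (\<lambda>y. c * f y) x = c * ?S f x" for c f
      by (simp add: kernel_operator_def mult.left_commute[of _ c])
    show "\<exists>C. \<forall>f\<in>L2_space M. L2_norm M (?S f) \<le> C * L2_norm M f"
      using S(2) by blast
  qed (rule S)
qed

text \<open>
  The definition picks some kernel of \<open>T\<close>.  This fixes that choice as \<open>k\<close>, so that statements
  about kernels can be applied to the symmetrization.
\<close>

lemma geometric_symmetrization_kernel:
  assumes op: "L2_bounded_operator M T" and ex: "\<exists>k. is_kernel_of M k T"
  obtains k where "is_kernel_of M k T"
    "L2_bounded_operator M (geometric_symmetrization M T)"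
    "is_kernel_of M (geometric_mean_kernel k) (geometric_symmetrization M T)"
    "\<And>D. 0 \<le> D \<Longrightarrow> L2_bound M (T \<circ> T) D \<Longrightarrow> L2_bound M (geometric_symmetrization M T) (sqrt D)"
proof -
  define k where "k = (SOME k. is_kernel_of M k T)"
  have k: "is_kernel_of M k T" unfolding k_def using ex by (rule someI_ex)
  have S: "geometric_symmetrization M T = kernel_operator M (geometric_mean_kernel k)"
    by (simp add: geometric_symmetrization_def k_def geometric_mean_kernel_def Let_def)
  have m: "geometric_mean_kernel k \<in> borel_measurable (M \<Otimes>\<^sub>M M)"
    using kernel_measurable[OF k] by measurable
  have p: "0 \<le> geometric_mean_kernel k (x, y)" if "x \<in> space M" "y \<in> space M" for x y
    using kernel_nonneg[OF k] that by (simp add: geometric_mean_kernel_def)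
  have b: "(\<integral>\<^sup>+x. (kernel_int M (geometric_mean_kernel k) (ennabs f) x)\<^sup>2 \<partial>M) \<le> ennreal ((sqrt D * L2_norm M f)\<^sup>2)"
    if "0 \<le> D" "L2_bound M (T \<circ> T) D" "f \<in> L2_space M" for D f
    using geometric_mean_kernel_int_bound[OF op k that(2,3)] that(1) by (simp add: power_mult_distrib)
  obtain D where D: "0 < D" "L2_bound M (T \<circ> T) D"
    using operator_bound[OF operator_compose[OF op op]] by blast
  have "L2_bounded_operator M (geometric_symmetrization M T)"
    "is_kernel_of M (geometric_mean_kernel k) (geometric_symmetrization M T)"
    unfolding S using kernel_operator_bounded[OF m p _ b[OF _ D(2)]] D(1) by auto
  moreover have "L2_bound M (geometric_symmetrization M T) (sqrt D)" if "0 \<le> D" "L2_bound M (T \<circ> T) D" for D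
    unfolding S using kernel_operator_bounded(3)[OF m p _ b[OF that]] that(1) by auto
  ultimately show ?thesis using that k by blast
qed

lemma square_kernel_eq:
  assumes op: "L2_bounded_operator M T" and k: "is_kernel_of M k T" and k2: "is_kernel_of M k2 (T \<circ> T)"
  shows "AE x in M. AE y in M. (\<integral>\<^sup>+z. ennreal (k (x, z)) * ennreal (k (z, y)) \<partial>M) = ennreal (k2 (x, y))"
proof -
  note [measurable] = kernel_measurable[OF k]
  let ?\<kappa> = "\<lambda>(x, y). \<integral>\<^sup>+z. ennreal (k (x, z)) * ennreal (k (z, y)) \<partial>M"
  have "AE p in M \<Otimes>\<^sub>M M. ?\<kappa> p = ennreal (k2 p)"
  proof (rule kernel_unique[OF operator_compose[OF op op] k2])
    show "?\<kappa> \<in> borel_measurable (M \<Otimes>\<^sub>M M)" by measurable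
    fix f assume f: "f \<in> L2_space M"
    note [measurable] = L2_measurable[OF f]
    have "AE x in M. kernel_int M k2 (ennabs f) x = kernel_int M k (kernel_int M k (ennabs f)) x"
      using kernel_of_abs(1)[OF k2 f] kernel_int_kernel_int[OF k op f] by eventually_elim simp
    then show "AE x in M. (\<integral>\<^sup>+y. ?\<kappa> (x, y) * ennabs f y \<partial>M) = kernel_int M k2 (ennabs f) x"
      using AE_space
    proof eventually_elim
      case (elim x)
      note [measurable] = elim(2)
      have "(\<integral>\<^sup>+y. ?\<kappa> (x, y) * ennabs f y \<partial>M) = (\<integral>\<^sup>+y. \<integral>\<^sup>+z. ennreal (k (x, z)) * ennreal (k (z, y)) * ennabs f y \<partial>M \<partial>M)"
        by (intro nn_integral_cong) (simp add: nn_integral_multc)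
      also have "\<dots> = (\<integral>\<^sup>+z. \<integral>\<^sup>+y. ennreal (k (x, z)) * ennreal (k (z, y)) * ennabs f y \<partial>M \<partial>M)"
        by (rule pair.Fubini') measurable
      also have "\<dots> = kernel_int M k (kernel_int M k (ennabs f)) x"
        unfolding kernel_int_def by (intro nn_integral_cong) (simp add: nn_integral_cmult mult.assoc)
      finally show ?case using elim(1) by simp
    qed
  qed
  from pair.AE_pair[OF this] show ?thesis by simp
qed

text \<open>
  The four factors under the square roots are regrouped so that Cauchy-Schwarz produces the kernel
  of \<open>T \<circ> T\<close> at \<open>(x, y)\<close> and at \<open>(y, x)\<close>.
\<close>

lemma geometric_mean_kernel_square:
  assumes op: "L2_bounded_operator M T" and k: "is_kernel_of M k T" and k2: "is_kernel_of M k2 (T \<circ> T)"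
  shows "AE x in M. AE y in M.
    (\<integral>\<^sup>+z. ennreal (geometric_mean_kernel k (x, z)) * ennreal (geometric_mean_kernel k (z, y)) \<partial>M)
      \<le> ennreal (geometric_mean_kernel k2 (x, y))"
proof -
  note [measurable] = kernel_measurable[OF k] kernel_measurable[OF k2]
  let ?\<kappa> = "\<lambda>x y. \<integral>\<^sup>+z. ennreal (k (x, z)) * ennreal (k (z, y)) \<partial>M"
  have 1: "AE x in M. AE y in M. ?\<kappa> x y = ennreal (k2 (x, y))"
    by (rule square_kernel_eq[OF op k k2])
  have 2: "AE x in M. AE y in M. ?\<kappa> y x = ennreal (k2 (y, x))"
    using 1 by (subst (asm) pair.AE_commute) measurable
  show ?thesis
    using 1 2 AE_space
  proof eventually_elim
    case (elim x)
    note [measurable] = elim(3)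
    show ?case
      using elim(1,2) AE_space
    proof eventually_elim
      case (elim y)
      note [measurable] = elim(3)
      have pos: "0 \<le> k (x, z)" "0 \<le> k (z, x)" "0 \<le> k (y, z)" "0 \<le> k (z, y)" if "z \<in> space M" for z
        using kernel_nonneg[OF k] that \<open>x \<in> space M\<close> \<open>y \<in> space M\<close> by auto
      have pos2: "0 \<le> k2 (x, y)" "0 \<le> k2 (y, x)"
        using kernel_nonneg[OF k2] \<open>x \<in> space M\<close> \<open>y \<in> space M\<close> by auto
      let ?a = "\<lambda>z. ennreal (sqrt (k (x, z) * k (z, y)))" and ?b = "\<lambda>z. ennreal (sqrt (k (y, z) * k (z, x)))"
      let ?I = "\<integral>\<^sup>+z. ennreal (geometric_mean_kernel k (x, z)) * ennreal (geometric_mean_kernel k (z, y)) \<partial>M"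
      have "?I = (\<integral>\<^sup>+z. ?a z * ?b z \<partial>M)"
        using pos by (intro nn_integral_cong)
          (simp add: geometric_mean_kernel_def real_sqrt_mult mult_ac flip: ennreal_mult)
      then have "?I\<^sup>2 \<le> (\<integral>\<^sup>+z. (?a z)\<^sup>2 \<partial>M) * (\<integral>\<^sup>+z. (?b z)\<^sup>2 \<partial>M)"
        by (simp only:) (intro Cauchy_Schwarz_nn_integral; measurable)
      also have "(\<integral>\<^sup>+z. (?a z)\<^sup>2 \<partial>M) = ?\<kappa> x y"
        using pos by (intro nn_integral_cong) (simp add: ennreal_power ennreal_mult)
      also have "(\<integral>\<^sup>+z. (?b z)\<^sup>2 \<partial>M) = ?\<kappa> y x"
        using pos by (intro nn_integral_cong) (simp add: ennreal_power ennreal_mult)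
      also have "?\<kappa> x y * ?\<kappa> y x = (ennreal (geometric_mean_kernel k2 (x, y)))\<^sup>2"
        using elim(1,2) pos2 by (simp add: geometric_mean_kernel_def ennreal_power flip: ennreal_mult)
      finally show ?case
        using pos2 by (intro ennreal_power2_le_imp_le) (auto simp: geometric_mean_kernel_def)
    qed
  qed
qed

lemma geometric_symmetrization_square_le:
  assumes op: "L2_bounded_operator M T" and ex: "\<exists>k. is_kernel_of M k T"
    and f: "f \<in> L2_space M" "AE x in M. 0 \<le> f x"
  shows "AE x in M. geometric_symmetrization M T (geometric_symmetrization M T f) x
    \<le> geometric_symmetrization M (T \<circ> T) f x"
proof -
  obtain k where k: "is_kernel_of M k T" "L2_bounded_operator M (geometric_symmetrization M T)"
    "is_kernel_of M (geometric_mean_kernel k) (geometric_symmetrization M T)"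
    using geometric_symmetrization_kernel[OF op ex] by blast
  have ex2: "\<exists>k. is_kernel_of M k (T \<circ> T)"
    using kernel_compose[OF op k(1) op k(1)] by blast
  obtain k2 where k2: "is_kernel_of M k2 (T \<circ> T)" "L2_bounded_operator M (geometric_symmetrization M (T \<circ> T))"
    "is_kernel_of M (geometric_mean_kernel k2) (geometric_symmetrization M (T \<circ> T))"
    using geometric_symmetrization_kernel[OF operator_compose[OF op op] ex2] by blast
  let ?S = "geometric_symmetrization M T" and ?S2 = "geometric_symmetrization M (T \<circ> T)"
  let ?s = "geometric_mean_kernel k" and ?s2 = "geometric_mean_kernel k2"
  note [measurable] = kernel_measurable[OF k(1)] kernel_measurable[OF k2(1)] L2_measurable[OF f(1)]
  note Spos = kernel_operator_positive[OF k(2,3)] and S2pos = kernel_operator_positive[OF k2(2,3)]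
  have "AE x in M. kernel_int M ?s (kernel_int M ?s (ennabs f)) x \<le> kernel_int M ?s2 (ennabs f) x"
    using geometric_mean_kernel_square[OF op k(1) k2(1)] AE_space
  proof eventually_elim
    case (elim x)
    note [measurable] = elim(2)
    have "kernel_int M ?s (kernel_int M ?s (ennabs f)) x
        = (\<integral>\<^sup>+z. \<integral>\<^sup>+y. ennreal (?s (x, z)) * ennreal (?s (z, y)) * ennabs f y \<partial>M \<partial>M)"
      unfolding kernel_int_def by (intro nn_integral_cong) (simp add: nn_integral_cmult mult.assoc)
    also have "\<dots> = (\<integral>\<^sup>+y. \<integral>\<^sup>+z. ennreal (?s (x, z)) * ennreal (?s (z, y)) * ennabs f y \<partial>M \<partial>M)"
      by (rule pair.Fubini') measurable
    also have "\<dots> = (\<integral>\<^sup>+y. (\<integral>\<^sup>+z. ennreal (?s (x, z)) * ennreal (?s (z, y)) \<partial>M) * ennabs f y \<partial>M)"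
      by (intro nn_integral_cong) (simp add: nn_integral_multc)
    also have "\<dots> \<le> kernel_int M ?s2 (ennabs f) x"
      unfolding kernel_int_def using elim(1)
      by (intro nn_integral_mono_AE) (auto elim!: eventually_mono intro!: mult_right_mono)
    finally show ?case .
  qed
  moreover have "AE x in M. kernel_int M ?s (kernel_int M ?s (ennabs f)) x = ennabs (?S (?S (L2_abs f))) x"
    by (rule kernel_int_kernel_int[OF k(3,2) f(1)])
  moreover have "AE x in M. kernel_int M ?s2 (ennabs f) x = ennabs (?S2 (L2_abs f)) x"
    by (rule kernel_of_abs(1)[OF k2(3) f(1)])
  moreover have Sf: "?S f \<in> L2_space M" "?S (L2_abs f) \<in> L2_space M"
    by (intro operator_closed[OF k(2)] L2_abs f)+
  have abs: "AE x in M. L2_abs f x = f x"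
    using f(2) by eventually_elim (rule L2_abs_of_nonneg)
  have "AE x in M. ?S (?S (L2_abs f)) x = ?S (?S f) x" "AE x in M. ?S2 (L2_abs f) x = ?S2 f x"
    by (intro operator_cong[OF k(2)] operator_cong[OF k2(2)] Sf L2_abs f abs)+
  moreover have "AE x in M. 0 \<le> ?S (?S f) x"
    by (intro positive_operator_nonneg[OF Spos] operator_closed[OF k(2)] f)
  moreover have "AE x in M. 0 \<le> ?S2 f x"
    by (intro positive_operator_nonneg[OF S2pos] f)
  ultimately show ?thesis
    by eventually_elim (simp add: less_eq_complex_def cmod_eq_Re)
qed

text \<open>
  By positivity the inequality for squares passes to \<open>S(T) ^^ (2 * m) \<le> S(T\<^sup>2) ^^ m\<close>.  The two
  halves of Gelfand's formula then translate it into spectral radii.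
\<close>

lemma geometric_symmetrization_radius_square_le:
  assumes op: "L2_bounded_operator M T" and ex: "\<exists>k. is_kernel_of M k T"
  shows "L2_spectral_radius M (geometric_symmetrization M T)
    \<le> sqrt (L2_spectral_radius M (geometric_symmetrization M (T \<circ> T)))"
proof -
  obtain k where k: "is_kernel_of M k T" "L2_bounded_operator M (geometric_symmetrization M T)"
    "is_kernel_of M (geometric_mean_kernel k) (geometric_symmetrization M T)"
    using geometric_symmetrization_kernel[OF op ex] by blast
  have ex2: "\<exists>k. is_kernel_of M k (T \<circ> T)"
    using kernel_compose[OF op k(1) op k(1)] by blast
  obtain k2 where k2: "is_kernel_of M k2 (T \<circ> T)" "L2_bounded_operator M (geometric_symmetrization M (T \<circ> T))"
    "is_kernel_of M (geometric_mean_kernel k2) (geometric_symmetrization M (T \<circ> T))"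
    using geometric_symmetrization_kernel[OF operator_compose[OF op op] ex2] by blast
  let ?S = "geometric_symmetrization M T" and ?S2 = "geometric_symmetrization M (T \<circ> T)"
  note Spos = kernel_operator_positive[OF k(2,3)] and S2pos = kernel_operator_positive[OF k2(2,3)]
  note Scl = operator_closed[OF operator_funpow[OF k(2)]] and S2cl = operator_closed[OF operator_funpow[OF k2(2)]]
  note Snn = positive_operator_nonneg[OF positive_operator_funpow[OF Spos]]
  have iter: "AE x in M. (?S ^^ (2 * m)) f x \<le> (?S2 ^^ m) f x"
    if f: "f \<in> L2_space M" "AE x in M. 0 \<le> f x" for f m
  proof (induction m)
    case (Suc m)
    have "AE x in M. ?S (?S ((?S ^^ (2 * m)) f)) x \<le> ?S2 ((?S ^^ (2 * m)) f) x"
      by (intro geometric_symmetrization_square_le op ex Scl Snn f)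
    moreover have "AE x in M. ?S2 ((?S ^^ (2 * m)) f) x \<le> ?S2 ((?S2 ^^ m) f) x"
      by (intro positive_operator_mono[OF S2pos] Scl S2cl f Suc)
    ultimately show ?case
      unfolding mult_Suc_right add_2_eq_Suc funpow.simps(2) comp_apply[of ?S] comp_apply[of ?S2]
      by eventually_elim (rule order_trans)
  qed simp
  have sq: "(L2_spectral_radius M ?S)\<^sup>2 \<le> L2_spectral_radius M ?S2"
  proof (rule dense_ge)
    fix t assume t: "L2_spectral_radius M ?S2 < t"
    then have t0: "0 < t" using spectrum_le_spectral_radius(1)[OF k2(2)] by linarith
    obtain m where m: "0 < m" "L2_bound M (?S2 ^^ m) (t ^ m)"
      using positive_operator_power_bound[OF S2pos t] by blast
    have "L2_bound M (?S ^^ (2 * m)) (sqrt t ^ (2 * m))"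
    proof (rule positive_operator_bound[OF positive_operator_funpow[OF Spos]])
      fix f assume f: "f \<in> L2_space M" "AE x in M. 0 \<le> f x"
      have "L2_norm M ((?S ^^ (2 * m)) f) \<le> L2_norm M ((?S2 ^^ m) f)"
        by (rule L2_norm_mono[OF L2_measurable[OF Scl[OF f(1)]] S2cl[OF f(1)] Snn[OF f] iter[OF f]])
      also have "\<dots> \<le> t ^ m * L2_norm M f"
        by (rule L2_boundD[OF m(2) f(1)])
      also have "t ^ m = sqrt t ^ (2 * m)"
        using t0 by (simp add: power_mult)
      finally show "L2_norm M ((?S ^^ (2 * m)) f) \<le> sqrt t ^ (2 * m) * L2_norm M f" .
    qed
    then have "L2_spectral_radius M ?S \<le> sqrt t"
      using m(1) t0 by (intro spectral_radius_le[OF k(2)]) auto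
    then have "(L2_spectral_radius M ?S)\<^sup>2 \<le> (sqrt t)\<^sup>2"
      using spectrum_le_spectral_radius(1)[OF k(2)] by (intro power_mono)
    then show "(L2_spectral_radius M ?S)\<^sup>2 \<le> t" using t0 by simp
  qed
  then show ?thesis by (rule real_le_rsqrt)
qed

lemma geometric_symmetrization_radius_le_norm:
  assumes op: "L2_bounded_operator M T" and ex: "\<exists>k. is_kernel_of M k T"
    and D: "0 \<le> D" "L2_bound M (T \<circ> T) D"
  shows "L2_spectral_radius M (geometric_symmetrization M T) \<le> sqrt D"
    and "0 \<le> L2_spectral_radius M (geometric_symmetrization M T)"
proof -
  have S: "L2_bounded_operator M (geometric_symmetrization M T)"
    "L2_bound M (geometric_symmetrization M T) (sqrt D)"
    using geometric_symmetrization_kernel[OF op ex] D by metis+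
  then show "L2_spectral_radius M (geometric_symmetrization M T) \<le> sqrt D"
    using spectral_radius_le[OF S(1), of 1 "sqrt D"] D by simp
  show "0 \<le> L2_spectral_radius M (geometric_symmetrization M T)"
    by (rule spectrum_le_spectral_radius(1)[OF S(1)])
qed

end

section \<open>Monotonicity and the upper bound\<close>

lemma funpow_double: "(f ^^ (2 ^ i)) \<circ> (f ^^ (2 ^ i)) = f ^^ (2 ^ Suc i)"
  by (simp add: mult_2 flip: funpow_add)

theorem theorem2p2:
  fixes M :: "'a measure"
    and K :: "('a \<Rightarrow> complex) \<Rightarrow> ('a \<Rightarrow> complex)"
    and n :: nat
  assumes "sigma_finite_measure M"
    and "positive_kernel_operator M K"
  shows "(\<forall>i<n. rho M K i \<le> rho M K (Suc i)) \<and> rho M K n \<le> L2_spectral_radius M K"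
proof -
  interpret sigma_finite_measure M by fact
  obtain k where K: "L2_bounded_operator M K" "is_kernel_of M k K"
    using assms(2) by (auto simp: positive_kernel_operator_def)
  let ?T = "\<lambda>i. K ^^ (2 ^ i)"
  let ?r = "\<lambda>i. L2_spectral_radius M (geometric_symmetrization M (?T i))"
  have op: "L2_bounded_operator M (?T i)" for i by (rule operator_funpow[OF K(1)])
  have ex: "\<exists>k. is_kernel_of M k (?T i)" for i
  proof (induction i)
    case (Suc i)
    then obtain k where "is_kernel_of M k (?T i)" by blast
    from kernel_compose[OF op this op this] show ?case
      unfolding funpow_double by blast
  qed (use K in auto)
  have r0: "0 \<le> ?r i" for i
  proof -
    obtain D where "0 < D" "L2_bound M (?T i \<circ> ?T i) D"
      using operator_bound[OF operator_compose[OF op op]] by blast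
    then show ?thesis using geometric_symmetrization_radius_le_norm(2)[OF op ex] by (meson less_imp_le)
  qed
  have step: "rho M K i \<le> rho M K (Suc i)" for i
  proof -
    have "?r i \<le> sqrt (?r (Suc i))"
      using geometric_symmetrization_radius_square_le[OF op ex, of i] by (simp only: funpow_double)
    then have "?r i powr (1 / 2 ^ i) \<le> sqrt (?r (Suc i)) powr (1 / 2 ^ i)"
      by (intro powr_mono2 r0) auto
    also have "\<dots> = ?r (Suc i) powr (1 / 2 ^ Suc i)"
      unfolding powr_half_sqrt[OF r0, symmetric] powr_powr by simp
    finally show ?thesis by (simp only: rho_def)
  qed
  have mono: "rho M K n \<le> rho M K j" if "n \<le> j" for j
    using step that by (rule lift_Suc_mono_le)
  \<comment> \<open>The bound on \<open>\<rho>\<^sub>j\<close> has a factor that disappears only in the limit \<open>j \<rightarrow> \<infinity>\<close>; monotonicity transfers the limit to \<open>\<rho>\<^sub>n\<close>.\<close>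
  have "rho M K n \<le> L2_spectral_radius M K"
  proof (rule dense_ge)
    fix t assume t: "L2_spectral_radius M K < t"
    then have t0: "0 < t" using spectrum_le_spectral_radius(1)[OF K(1)] by linarith
    obtain m where m: "0 < m" "L2_bound M (K ^^ m) (t ^ m)"
      using positive_operator_power_bound[OF kernel_operator_positive[OF K] t] by blast
    obtain B where B: "0 < B" "\<And>n. L2_bound M (K ^^ n) (B * t ^ n)"
      using power_bound_all[OF K(1) m(1) t0 m(2)] by blast
    have bound: "rho M K j \<le> B powr (1 / 2 ^ Suc j) * t" for j
    proof -
      have "L2_bound M (?T j \<circ> ?T j) (B * t ^ 2 ^ Suc j)"
        unfolding funpow_double by (rule B(2))
      then have "?r j \<le> sqrt (B * t ^ 2 ^ Suc j)"
        using B(1) t0 by (intro geometric_symmetrization_radius_le_norm(1)[OF op ex]) auto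
      then have "rho M K j \<le> sqrt (B * t ^ 2 ^ Suc j) powr (1 / 2 ^ j)"
        unfolding rho_def by (intro powr_mono2 r0) auto
      also have "\<dots> = (B * t powr (2 ^ Suc j)) powr (1 / 2 ^ Suc j)"
        using B(1) t0 by (simp add: powr_half_sqrt[symmetric] powr_powr flip: powr_realpow)
      also have "\<dots> = B powr (1 / 2 ^ Suc j) * t"
        using B(1) t0 by (simp add: powr_mult powr_powr)
      finally show ?thesis .
    qed
    have "(\<lambda>j. B powr (1 / 2 ^ Suc j) * t) \<longlonglongrightarrow> B powr 0 * t"
    proof (intro tendsto_mult tendsto_powr tendsto_const)
      have "(\<lambda>j. (1 / 2 :: real) ^ Suc j) \<longlonglongrightarrow> 0"
        by (intro LIMSEQ_Suc LIMSEQ_realpow_zero) auto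
      then show "(\<lambda>j. 1 / 2 ^ Suc j :: real) \<longlonglongrightarrow> 0"
        by (simp add: power_divide)
    qed (use B in auto)
    then have "rho M K n \<le> B powr 0 * t"
      by (rule Lim_bounded2[where N = n]) (meson bound mono order_trans)
    then show "rho M K n \<le> t" using B by simp
  qed
  with step show ?thesis by blast
qed

end
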